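(* Every matching covered graph $G$ has $\Theta$ as a conformal minor or has $K_4$ as a conformal minor (or both).
   Context: Graphs are loopless; multiple (parallel) edges are allowed. A graph is matchable if it has a perfect matching. A connected graph, of order two or more, is matching covered if each edge lies in some perfect matching. $\Theta$ is the graph with two vertices joined by three edges. A subgraph $H$ of a graph $G$ is conformal if the graph $G-V(H)$ is matchable (the empty graph is regarded as matchable). To bi-subdivide an edge means to subdivide it by inserting an even number of subdivision vertices; a graph $H$ is a bi-subdivision of a graph $J$ if $H$ may be obtained from $J$ by bi-subdividing each edge in some subset of $E(J)$. A matching covered graph $J$ is a conformal minor of a matching covered graph $G$ if $G$ has a conformal subgraph that is a bi-subdivision of $J$.
   Formalization: The graph G is additionally assumed not to be K_2 or an even cycle (including two vertices joined by two parallel edges); these are matching covered but have maximum degree at most 2, so neither Θ nor K_4 is a conformal minor of them. *)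

theory Defs
  imports Main
begin

text \<open>
  Finite loopless undirected graphs with parallel edges: edges are named objects, and
  each edge has a two-element set of ends.
\<close>

record ('v, 'e) mgraph =
  verts :: "'v set"
  edges :: "'e set"
  ends :: "'e \<Rightarrow> 'v set"

definition multigraph :: "('v, 'e) mgraph \<Rightarrow> bool" where
  "multigraph G \<longleftrightarrow> finite (verts G) \<and> finite (edges G) \<and>
     (\<forall>e\<in>edges G. ends G e \<subseteq> verts G \<and> card (ends G e) = 2)"

definition adjacency :: "('v, 'e) mgraph \<Rightarrow> ('v \<times> 'v) set" where
  "adjacency G = {(u, v). \<exists>e\<in>edges G. ends G e = {u, v}}"

definition connected_graph :: "('v, 'e) mgraph \<Rightarrow> bool" where
  "connected_graph G \<longleftrightarrow> verts G \<noteq> {} \<and>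
     (\<forall>u\<in>verts G. \<forall>v\<in>verts G. (u, v) \<in> (adjacency G)\<^sup>*)"

definition perfect_matching :: "('v, 'e) mgraph \<Rightarrow> 'e set \<Rightarrow> bool" where
  "perfect_matching G M \<longleftrightarrow> M \<subseteq> edges G \<and> (\<forall>v\<in>verts G. \<exists>!e. e \<in> M \<and> v \<in> ends G e)"

definition matchable :: "('v, 'e) mgraph \<Rightarrow> bool" where
  "matchable G \<longleftrightarrow> (\<exists>M. perfect_matching G M)"

definition matching_covered :: "('v, 'e) mgraph \<Rightarrow> bool" where
  "matching_covered G \<longleftrightarrow> multigraph G \<and> connected_graph G \<and> card (verts G) \<ge> 2 \<and>
     (\<forall>e\<in>edges G. \<exists>M. perfect_matching G M \<and> e \<in> M)"

definition subgraph :: "('v, 'e) mgraph \<Rightarrow> ('v, 'e) mgraph \<Rightarrow> bool" where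
  "subgraph H G \<longleftrightarrow> multigraph H \<and> verts H \<subseteq> verts G \<and> edges H \<subseteq> edges G \<and>
     (\<forall>e\<in>edges H. ends H e = ends G e)"

definition delete_verts :: "('v, 'e) mgraph \<Rightarrow> 'v set \<Rightarrow> ('v, 'e) mgraph" where
  "delete_verts G X =
     \<lparr>verts = verts G - X, edges = {e\<in>edges G. ends G e \<inter> X = {}}, ends = ends G\<rparr>"

definition conformal :: "('v, 'e) mgraph \<Rightarrow> ('v, 'e) mgraph \<Rightarrow> bool" where
  "conformal H G \<longleftrightarrow> subgraph H G \<and> matchable (delete_verts G (verts H))"

definition isomorphic :: "('v, 'e) mgraph \<Rightarrow> ('w, 'f) mgraph \<Rightarrow> bool" where
  "isomorphic G H \<longleftrightarrow> (\<exists>f g. bij_betw f (verts G) (verts H) \<and> bij_betw g (edges G) (edges H) \<and>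
     (\<forall>e\<in>edges G. ends H (g e) = f ` ends G e))"

text \<open>
  \<open>subdivide J s t k\<close> replaces each edge \<open>e\<close> of \<open>J\<close>, with ends \<open>s e\<close> and \<open>t e\<close>, by the path
  \<open>s e, (e,1), \<dots>, (e, k e), t e\<close> with \<open>k e\<close> new inner vertices; its edges are
  \<open>(e,0), \<dots>, (e, k e)\<close>, where \<open>(e,i)\<close> joins the \<open>i\<close>-th vertex of the path to the next one
  (counting from 0). An edge with \<open>k e = 0\<close> is left as it is. The original vertices are
  tagged \<open>Inl\<close>, the new ones \<open>Inr\<close>.
\<close>

definition path_vertex ::
  "('b \<Rightarrow> 'a) \<Rightarrow> ('b \<Rightarrow> 'a) \<Rightarrow> ('b \<Rightarrow> nat) \<Rightarrow> 'b \<Rightarrow> nat \<Rightarrow> 'a + 'b \<times> nat" where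
  "path_vertex s t k e i =
     (if i = 0 then Inl (s e) else if i \<le> k e then Inr (e, i) else Inl (t e))"

definition subdivide ::
  "('a, 'b) mgraph \<Rightarrow> ('b \<Rightarrow> 'a) \<Rightarrow> ('b \<Rightarrow> 'a) \<Rightarrow> ('b \<Rightarrow> nat) \<Rightarrow> ('a + 'b \<times> nat, 'b \<times> nat) mgraph"
  where
  "subdivide J s t k =
     \<lparr>verts = Inl ` verts J \<union> Inr ` (SIGMA e:edges J. {1..k e}),
      edges = (SIGMA e:edges J. {0..k e}),
      ends = (\<lambda>(e, i). {path_vertex s t k e i, path_vertex s t k e (Suc i)})\<rparr>"

definition bi_subdivision :: "('v, 'e) mgraph \<Rightarrow> ('a, 'b) mgraph \<Rightarrow> bool" where
  "bi_subdivision H J \<longleftrightarrow> (\<exists>s t k. (\<forall>e\<in>edges J. ends J e = {s e, t e} \<and> even (k e)) \<and>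
     isomorphic H (subdivide J s t k))"

text \<open>Intended for matching covered \<open>J\<close> and \<open>G\<close>.\<close>

definition conformal_minor :: "('a, 'b) mgraph \<Rightarrow> ('v, 'e) mgraph \<Rightarrow> bool" where
  "conformal_minor J G \<longleftrightarrow> (\<exists>H. conformal H G \<and> bi_subdivision H J)"

definition Theta :: "(nat, nat) mgraph" where
  "Theta = \<lparr>verts = {0, 1}, edges = {0, 1, 2}, ends = (\<lambda>_. {0, 1})\<rparr>"

definition complete_graph :: "nat \<Rightarrow> (nat, nat set) mgraph" where
  "complete_graph n = \<lparr>verts = {0..<n}, edges = {e. e \<subseteq> {0..<n} \<and> card e = 2}, ends = (\<lambda>e. e)\<rparr>"

text \<open>
  Only meaningful for \<open>n \<ge> 2\<close>; \<open>cycle_graph 2\<close> has two vertices joined by two parallel edges.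
\<close>

definition cycle_graph :: "nat \<Rightarrow> (nat, nat) mgraph" where
  "cycle_graph n = \<lparr>verts = {0..<n}, edges = {0..<n}, ends = (\<lambda>i. {i, Suc i mod n})\<rparr>"

text \<open>
  \<open>K\<^sub>2\<close> and the even cycles, including the one of length 2, are the matching covered graphs of
  maximum degree at most 2; they contain no bi-subdivision of \<open>\<Theta>\<close> or \<open>K\<^sub>4\<close> at all.
\<close>

definition K2_or_even_cycle :: "('v, 'e) mgraph \<Rightarrow> bool" where
  "K2_or_even_cycle G \<longleftrightarrow> isomorphic G (complete_graph 2) \<or>
     (\<exists>n\<ge>2. even n \<and> isomorphic G (cycle_graph n))"

end

theory Submission
  imports Defs
begin

text \<open>
  Let \<open>C\<close> be an even cycle, \<open>M\<close> a perfect matching of \<open>G - V(C)\<close> and \<open>N\<close> a perfect matching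
  of \<open>G\<close> that contains an edge outside \<open>C\<close> with an end on \<open>C\<close>. From each vertex of \<open>C\<close> whose
  \<open>N\<close>-edge is not in \<open>C\<close>, walk along \<open>N\<close>- and \<open>M\<close>-edges alternately until \<open>C\<close> is reached again.
  This yields disjoint ears of \<open>C\<close> of odd length, and \<open>C\<close> together with any set of them is
  conformal. An ear whose ends lie at odd distance on \<open>C\<close> gives a bi-subdivision of \<open>\<Theta>\<close>. Otherwise
  take an ear with ends \<open>i < j\<close> at minimal distance: since \<open>N\<close> cannot pair up the vertices
  \<open>i + 1, \<dots>, j\<close> along \<open>C\<close>, another ear starts at some \<open>p\<close> strictly between \<open>i\<close> and \<open>j\<close> at odd
  distance from both. By minimality it ends outside \<open>[i, j]\<close>, so the two ears cross, which gives
  a bi-subdivision of \<open>K\<^sub>4\<close>.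

  The cycle \<open>C\<close> is found in the same way: start with an edge \<open>v w\<close> of a perfect matching in place
  of \<open>C\<close> and with a perfect matching \<open>N\<close> that contains another edge at \<open>v\<close>; the walk from \<open>v\<close> can
  only end in \<open>w\<close>.
\<close>

section \<open>Isomorphisms, and conformal minors given by systems of paths\<close>

lemma isomorphic_sym:
  assumes iso: "isomorphic G H" and sub: "\<And>e. e \<in> edges G \<Longrightarrow> ends G e \<subseteq> verts G"
  shows "isomorphic H G"
proof -
  obtain f g where f: "bij_betw f (verts G) (verts H)" and g: "bij_betw g (edges G) (edges H)"
    and fg: "\<And>e. e \<in> edges G \<Longrightarrow> ends H (g e) = f ` ends G e"
    using iso unfolding isomorphic_def by blast
  let ?f = "inv_into (verts G) f" and ?g = "inv_into (edges G) g"
  have "ends G (?g e) = ?f ` ends H e" if e: "e \<in> edges H" for e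
  proof -
    have e': "?g e \<in> edges G" and ge: "g (?g e) = e"
      using e g by (auto simp: bij_betw_def inv_into_into f_inv_into_f)
    \<comment> \<open>\<open>?f\<close> undoes \<open>f\<close> only on \<open>verts G\<close>; here
      the assumption that ends are vertices enters.\<close>
    have "?f ` f ` ends G (?g e) = ends G (?g e)"
      using sub[OF e'] f by (auto simp: bij_betw_def image_image image_subset_iff subset_iff)
    thus ?thesis using fg[OF e'] ge by simp
  qed
  thus ?thesis
    unfolding isomorphic_def using bij_betw_inv_into[OF f] bij_betw_inv_into[OF g] by blast
qed

text \<open>Describes a copy of \<open>subdivide J s t k\<close> in \<open>G\<close>:
  \<open>\<phi>\<close> places the branch vertices, \<open>P e\<close> with indices 0 to
  \<open>Suc (k e)\<close> lists the vertices of the path replacing \<open>e\<close>, and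
  \<open>Q e\<close> with indices 0 to \<open>k e\<close> its edges. Edges of different paths are
  separated by an assumption of their own, since parallel edges of \<open>J\<close> with
  \<open>k e = 0\<close> have images with the same ends.\<close>

lemma conformal_minorI:
  fixes G :: "('v, 'e) mgraph" and J :: "('a, 'b) mgraph"
  assumes G: "multigraph G" and J: "multigraph J"
    and st: "\<And>e. e \<in> edges J \<Longrightarrow> ends J e = {s e, t e} \<and> even (k e)"
    and inj_br: "inj_on \<phi> (verts J)" and br: "\<phi> ` verts J \<subseteq> verts G"
    and P0: "\<And>e. e \<in> edges J \<Longrightarrow> P e 0 = \<phi> (s e)"
    and Pk: "\<And>e. e \<in> edges J \<Longrightarrow> P e (Suc (k e)) = \<phi> (t e)"
    and Q: "\<And>e i. e \<in> edges J \<Longrightarrow> i \<le> k e \<Longrightarrow> Q e i \<in> edges G \<and> ends G (Q e i) = {P e i, P e (Suc i)}"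
    and injP: "\<And>e. e \<in> edges J \<Longrightarrow> inj_on (P e) {0..Suc (k e)}"
    and int_br: "\<And>e i. e \<in> edges J \<Longrightarrow> 0 < i \<Longrightarrow> i \<le> k e \<Longrightarrow> P e i \<notin> \<phi> ` verts J"
    and disj: "\<And>e e' i j. \<lbrakk>e \<in> edges J; e' \<in> edges J; e \<noteq> e'; 0 < i; i \<le> k e; 0 < j; j \<le> k e'\<rbrakk>
                 \<Longrightarrow> P e i \<noteq> P e' j"
    and disjQ: "\<And>e e' i j. \<lbrakk>e \<in> edges J; e' \<in> edges J; e \<noteq> e'; i \<le> k e; j \<le> k e'\<rbrakk>
                 \<Longrightarrow> Q e i \<noteq> Q e' j"
    and rest: "matchable (delete_verts G (\<phi> ` verts J \<union> (\<Union>e\<in>edges J. P e ` {1..k e})))"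
  shows "conformal_minor J G"
proof -
  define H where "H = \<lparr>verts = \<phi> ` verts J \<union> (\<Union>e\<in>edges J. P e ` {1..k e}),
    edges = (\<lambda>(e, i). Q e i) ` (SIGMA e:edges J. {0..k e}), ends = ends G\<rparr>"
  let ?S = "subdivide J s t k"
  define F where "F = case_sum \<phi> (\<lambda>(e, i). P e i)"
  have PV: "P e i \<in> verts H" if "e \<in> edges J" "i \<le> Suc (k e)" for e i
  proof -
    have stJ: "s e \<in> verts J" "t e \<in> verts J"
      using that(1) J st[OF that(1)] by (auto simp: multigraph_def)
    have "i = 0 \<or> i = Suc (k e) \<or> i \<in> {1..k e}" using that(2) by auto
    then consider "i = 0" | "i = Suc (k e)" | "i \<in> {1..k e}" by blast
    thus ?thesis
    proof cases
      case 1 thus ?thesis using P0[OF that(1)] stJ by (simp add: H_def)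
    next
      case 2 thus ?thesis using Pk[OF that(1)] stJ by (simp add: H_def)
    next
      case 3
      hence "P e i \<in> (\<Union>e\<in>edges J. P e ` {1..k e})" by (intro UN_I[OF that(1)] imageI)
      thus ?thesis by (simp add: H_def)
    qed
  qed
  have Fp: "F (path_vertex s t k e i) = P e i" if "e \<in> edges J" "i \<le> Suc (k e)" for e i
    using that P0[OF that(1)] Pk[OF that(1)] le_Suc_eq[of i "k e"]
    by (auto simp: F_def path_vertex_def)
  have bijV: "bij_betw F (verts ?S) (verts H)"
  proof (rule bij_betw_imageI)
    show "inj_on F (verts ?S)"
    proof (rule inj_onI)
      fix x y assume x: "x \<in> verts ?S" and y: "y \<in> verts ?S" and eq: "F x = F y"
      have *: "i = j" if "e \<in> edges J" "P e i = P e j" "i \<le> k e" "j \<le> k e" for e i j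
        using inj_onD[OF injP[OF that(1)] that(2)] that(3,4) by auto
      show "x = y"
      proof (cases x; cases y)
        fix a b assume "x = Inl a" "y = Inl b"
        thus ?thesis using x y eq inj_br by (auto simp: F_def subdivide_def inj_on_def)
      next
        fix a b assume xy: "x = Inl a" "y = Inr b"
        have "F y \<in> \<phi> ` verts J" using eq[symmetric] xy x by (auto simp: F_def subdivide_def)
        thus ?thesis using y xy int_br[of "fst b" "snd b"]
          by (auto simp: F_def subdivide_def)
      next
        fix a b assume xy: "x = Inr a" "y = Inl b"
        have "F x \<in> \<phi> ` verts J" using eq xy y by (auto simp: F_def subdivide_def)
        thus ?thesis using x xy int_br[of "fst a" "snd a"]
          by (auto simp: F_def subdivide_def)
      next
        fix a b assume xy: "x = Inr a" "y = Inr b"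
        obtain e i e' j where ab: "a = (e, i)" "b = (e', j)" by fastforce
        have i: "e \<in> edges J" "0 < i" "i \<le> k e" and j: "e' \<in> edges J" "0 < j" "j \<le> k e'"
          using x y xy ab by (auto simp: subdivide_def)
        have "P e i = P e' j" using eq xy ab by (simp add: F_def)
        thus ?thesis using i j disj[of e e' i j] * xy ab by auto
      qed
    qed
    show "F ` verts ?S = verts H"
      by (force simp: F_def H_def subdivide_def image_Un image_image)
  qed
  \<comment> \<open>Equal edges have equal end sets. Matching the ends crosswise would give
    \<open>i = Suc j\<close> and \<open>Suc i = j\<close>.\<close>
  have Qinj: "i = j" if e: "e \<in> edges J" "i \<le> k e" "j \<le> k e" "Q e i = Q e j" for e i j
  proof -
    have "{P e i, P e (Suc i)} = {P e j, P e (Suc j)}" using Q e by metis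
    hence "(P e i = P e j \<and> P e (Suc i) = P e (Suc j)) \<or> (P e i = P e (Suc j) \<and> P e (Suc i) = P e j)"
      by (auto simp: doubleton_eq_iff)
    thus ?thesis
      using inj_onD[OF injP[OF e(1)], of i j] inj_onD[OF injP[OF e(1)], of i "Suc j"]
        inj_onD[OF injP[OF e(1)], of "Suc i" j] e by auto
  qed
  have bijE: "bij_betw (\<lambda>(e, i). Q e i) (edges ?S) (edges H)"
  proof (rule bij_betw_imageI)
    show "inj_on (\<lambda>(e, i). Q e i) (edges ?S)"
    proof (rule inj_onI, clarify)
      fix e i e' j assume "(e, i) \<in> edges ?S" "(e', j) \<in> edges ?S" "Q e i = Q e' j"
      thus "e = e' \<and> i = j" using disjQ[of e e' i j] Qinj[of e i j]
        by (cases "e = e'") (auto simp: subdivide_def)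
    qed
    show "(\<lambda>(e, i). Q e i) ` edges ?S = edges H" by (simp add: H_def subdivide_def)
  qed
  have HE: "ends H (case x of (e, i) \<Rightarrow> Q e i) = F ` ends ?S x" if x_in: "x \<in> edges ?S" for x
  proof -
    obtain e i where x: "x = (e, i)" "e \<in> edges J" "i \<le> k e"
      using x_in by (auto simp: subdivide_def)
    thus ?thesis using Q[OF x(2,3)] Fp[OF x(2), of i] Fp[OF x(2), of "Suc i"]
      by (simp add: H_def subdivide_def)
  qed
  have "isomorphic ?S H" unfolding isomorphic_def using bijV bijE HE by blast
  moreover have "ends ?S x \<subseteq> verts ?S" if x_in: "x \<in> edges ?S" for x
  proof -
    obtain e i where x: "x = (e, i)" "e \<in> edges J" "i \<le> k e"
      using x_in by (auto simp: subdivide_def)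
    have "s e \<in> verts J" "t e \<in> verts J"
      using x(2) J st[OF x(2)] by (auto simp: multigraph_def)
    thus ?thesis using x by (auto simp: subdivide_def path_vertex_def)
  qed
  ultimately have "isomorphic H ?S" by (rule isomorphic_sym)
  hence "bi_subdivision H J" unfolding bi_subdivision_def using st by blast
  moreover have "conformal H G"
  proof -
    have E: "e \<in> edges G \<and> ends G e \<subseteq> verts H" if "e \<in> edges H" for e
    proof -
      obtain d i where d: "e = Q d i" "d \<in> edges J" "i \<le> k d"
        using \<open>e \<in> edges H\<close> by (auto simp: H_def)
      show ?thesis using Q[OF d(2,3)] PV[OF d(2), of i] PV[OF d(2), of "Suc i"] d by auto
    qed
    have "verts H \<subseteq> verts G"
    proof
      fix v assume "v \<in> verts H"
      then consider "v \<in> \<phi> ` verts J" | e i where "e \<in> edges J" "i \<le> k e" "v = P e i"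
        by (auto simp: H_def)
      thus "v \<in> verts G"
      proof cases
        case 2
        thus ?thesis using Q[OF 2(1,2)] G by (fastforce simp: multigraph_def)
      qed (use br in blast)
    qed
    moreover have "finite (verts H)" "finite (edges H)"
      using J by (auto simp: H_def multigraph_def)
    ultimately have "subgraph H G"
      using E G unfolding subgraph_def multigraph_def by (auto simp: H_def)
    moreover have "matchable (delete_verts G (verts H))" using rest by (simp add: H_def)
    ultimately show ?thesis by (simp add: conformal_def)
  qed
  ultimately show ?thesis unfolding conformal_minor_def by blast
qed

subsection \<open>Perfect matchings and alternating walks\<close>

definition mate_edge :: "('v, 'e) mgraph \<Rightarrow> 'e set \<Rightarrow> 'v \<Rightarrow> 'e" where
  "mate_edge G M v = (THE e. e \<in> M \<and> v \<in> ends G e)"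

definition mate :: "('v, 'e) mgraph \<Rightarrow> 'e set \<Rightarrow> 'v \<Rightarrow> 'v" where
  "mate G M v = (THE w. ends G (mate_edge G M v) = {v, w})"

context
  fixes G :: "('v, 'e) mgraph" and M :: "'e set"
  assumes G: "multigraph G" and M: "perfect_matching G M"
begin

lemma mate_edge_eq: "e \<in> M \<Longrightarrow> v \<in> ends G e \<Longrightarrow> mate_edge G M v = e"
proof -
  assume e: "e \<in> M" "v \<in> ends G e"
  hence "v \<in> verts G" using G M by (auto simp: multigraph_def perfect_matching_def)
  hence "\<exists>!e. e \<in> M \<and> v \<in> ends G e" using M by (simp add: perfect_matching_def)
  thus ?thesis unfolding mate_edge_def using e by (simp add: the1_equality)
qed

lemma mate:
  assumes v: "v \<in> verts G"
  shows mate_edge_in: "mate_edge G M v \<in> M"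
    and ends_mate_edge: "ends G (mate_edge G M v) = {v, mate G M v}"
    and mate_neq: "mate G M v \<noteq> v"
    and mate_in: "mate G M v \<in> verts G"
    and mate_mate: "mate G M (mate G M v) = v"
proof -
  have "\<exists>!e. e \<in> M \<and> v \<in> ends G e" using M v by (simp add: perfect_matching_def)
  from ex1_implies_ex[OF this] obtain e where e: "e \<in> M" "v \<in> ends G e" by blast
  have me: "mate_edge G M v = e" using e by (rule mate_edge_eq)
  have eG: "e \<in> edges G" using e(1) M unfolding perfect_matching_def by blast
  have "card (ends G e) = 2" and sub: "ends G e \<subseteq> verts G"
    using G eG unfolding multigraph_def by blast+
  then obtain x y where xy: "ends G e = {x, y}" "x \<noteq> y" unfolding card_2_iff by blast
  define w where "w = (if v = x then y else x)"
  have w: "ends G e = {v, w}" "w \<noteq> v" using xy e(2) unfolding w_def by auto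
  have mw: "mate G M v = w"
    unfolding mate_def me w(1) using w(2) by (intro the_equality) (auto simp: doubleton_eq_iff)
  have "mate_edge G M w = e" using e(1) w(1) by (intro mate_edge_eq) simp_all
  hence "mate G M w = v"
    unfolding mate_def using w by (intro the_equality) (auto simp: doubleton_eq_iff)
  thus "mate_edge G M v \<in> M" "ends G (mate_edge G M v) = {v, mate G M v}"
    "mate G M v \<noteq> v" "mate G M v \<in> verts G" "mate G M (mate G M v) = v"
    using w sub e(1) by (simp_all add: mw me)
qed

end

lemma multigraph_delete_verts: "multigraph G \<Longrightarrow> multigraph (delete_verts G X)"
  unfolding multigraph_def delete_verts_def by auto

text \<open>The vertices of \<open>Y\<close> outside \<open>X\<close> have their partners in
  \<open>Y\<close>, so \<open>M\<close> matches them among themselves, and the edges of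
  \<open>M\<close> that avoid \<open>Y\<close> still cover everything else.\<close>

lemma matchable_delete_verts_mono:
  assumes G: "multigraph G" and M: "perfect_matching (delete_verts G X) M" and XY: "X \<subseteq> Y"
    and closed: "\<And>v. v \<in> verts G - X \<Longrightarrow> v \<in> Y \<Longrightarrow> mate (delete_verts G X) M v \<in> Y"
  shows "matchable (delete_verts G Y)"
proof -
  let ?D = "delete_verts G X"
  note D = multigraph_delete_verts[OF G, of X]
  let ?N = "{e \<in> M. ends G e \<inter> Y = {}}"
  have "\<exists>!e. e \<in> ?N \<and> v \<in> ends G e" if v: "v \<in> verts G - Y" for v
  proof -
    have vD: "v \<in> verts ?D" using v XY by (auto simp: delete_verts_def)
    note m = mate[OF D M vD]
    have "mate ?D M v \<notin> Y"
      using m(4,5) closed[of "mate ?D M v"] v by (simp add: delete_verts_def) metis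
    moreover have "ends G (mate_edge ?D M v) = {v, mate ?D M v}"
      using m(2) by (simp add: delete_verts_def)
    ultimately have "mate_edge ?D M v \<in> ?N \<and> v \<in> ends G (mate_edge ?D M v)"
      using m(1) v by simp
    moreover have "e = mate_edge ?D M v" if "e \<in> M" "v \<in> ends G e" for e
      using mate_edge_eq[OF D M that(1), of v] that(2) by (simp add: delete_verts_def)
    ultimately show ?thesis by (intro ex1I[of _ "mate_edge ?D M v"]) simp_all
  qed
  moreover have "?N \<subseteq> edges (delete_verts G Y)"
    using M by (auto simp: perfect_matching_def delete_verts_def)
  ultimately have "perfect_matching (delete_verts G Y) ?N"
    by (simp add: perfect_matching_def delete_verts_def)
  thus ?thesis unfolding matchable_def by blast
qed

text \<open>The walks use only two fixed-point-free involutions: \<open>n\<close> for partners in a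
  perfect matching of the whole graph, \<open>m\<close> for partners in one of the graph without
  \<open>X\<close>. Nothing is assumed about \<open>m\<close> on \<open>X\<close>, so a walk is
  meaningful only up to its first return to \<open>X\<close>.\<close>

locale alternating_walk =
  fixes V X :: "'v set" and n m :: "'v \<Rightarrow> 'v"
  assumes fin: "finite V" and XV: "X \<subseteq> V"
    and n_in: "v \<in> V \<Longrightarrow> n v \<in> V" and n_neq: "v \<in> V \<Longrightarrow> n v \<noteq> v" and n_n: "v \<in> V \<Longrightarrow> n (n v) = v"
    and m_in: "v \<in> V - X \<Longrightarrow> m v \<in> V - X" and m_neq: "v \<in> V - X \<Longrightarrow> m v \<noteq> v"
    and m_m: "v \<in> V - X \<Longrightarrow> m (m v) = v"
begin

primrec walk :: "'v \<Rightarrow> nat \<Rightarrow> 'v" where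
  "walk u 0 = u"
| "walk u (Suc k) = (if even k then n (walk u k) else m (walk u k))"

lemma walk_in: "u \<in> X \<Longrightarrow> (\<And>j. 0 < j \<Longrightarrow> j < k \<Longrightarrow> walk u j \<notin> X) \<Longrightarrow> walk u k \<in> V"
proof (induction k)
  case 0 thus ?case using XV by auto
next
  case (Suc k)
  have k: "walk u k \<in> V" using Suc by simp
  show ?case
  proof (cases "even k")
    case True thus ?thesis using k n_in by simp
  next
    case False
    hence "walk u k \<notin> X" using Suc.prems(2)[of k] by (cases k) auto
    thus ?thesis using False k m_in by auto
  qed
qed

text \<open>Two walks at a common vertex, after step counts of equal parity, got there by the same
  involution, so the step can be undone in both. Avoidance of \<open>X\<close> is assumed only
  before \<open>a\<close> and \<open>b\<close>, because a first return is not yet known to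
  exist.\<close>

lemma walk_back:
  assumes u: "u \<in> X" "\<And>j. 0 < j \<Longrightarrow> j < a \<Longrightarrow> walk u j \<notin> X"
    and v: "v \<in> X" "\<And>j. 0 < j \<Longrightarrow> j < b \<Longrightarrow> walk v j \<notin> X"
    and ab: "even a \<longleftrightarrow> even b" and eq: "walk u a = walk v b"
  shows "t \<le> a \<Longrightarrow> t \<le> b \<Longrightarrow> walk u (a - t) = walk v (b - t)"
proof (induction t)
  case 0 thus ?case using eq by simp
next
  case (Suc t)
  define i j where "i = a - Suc t" and "j = b - Suc t"
  have i: "a - t = Suc i" and j: "b - t = Suc j" using Suc.prems by (auto simp: i_def j_def)
  have IH: "walk u (Suc i) = walk v (Suc j)" using Suc i j by simp
  have par: "even i \<longleftrightarrow> even j"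
    using ab Suc.prems unfolding i_def j_def by presburger
  have ia: "i < a" and jb: "j < b" using Suc.prems by (auto simp: i_def j_def)
  have iV: "walk u i \<in> V" using u ia by (intro walk_in) auto
  have jV: "walk v j \<in> V" using v jb by (intro walk_in) auto
  have "walk u i = walk v j"
  proof (cases "even i")
    case True
    hence "n (walk u i) = n (walk v j)" using IH par by simp
    from arg_cong[OF this, of n] show ?thesis by (simp only: n_n[OF iV] n_n[OF jV])
  next
    case False
    \<comment> \<open>Position 0 lies in \<open>X\<close>, where \<open>m\<close> need not be an
      involution; odd positions are positive and hence outside \<open>X\<close>.\<close>
    hence "0 < i" "0 < j" using par odd_pos by blast+
    hence "walk u i \<in> V - X" "walk v j \<in> V - X" using iV jV ia jb u(2) v(2) by auto
    note V = this
    have "m (walk u i) = m (walk v j)" using IH par False by simp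
    from arg_cong[OF this, of m] show ?thesis by (simp only: m_m[OF V(1)] m_m[OF V(2)])
  qed
  thus ?case by (simp add: i_def j_def)
qed

text \<open>Otherwise finiteness of \<open>V\<close> forces a repetition among the even positions,
  and tracing it back to the start yields a later visit to \<open>u\<close> itself. Even positions
  provide the equal parity that tracing back requires.\<close>

lemma walk_returns:
  assumes u: "u \<in> X" shows "\<exists>k>0. walk u k \<in> X"
proof (rule ccontr)
  assume "\<not> ?thesis"
  hence no: "\<And>k. 0 < k \<Longrightarrow> walk u k \<notin> X" by blast
  have "range (\<lambda>k. walk u (2 * k)) \<subseteq> V" using walk_in[OF u] no by auto
  hence "\<not> inj (\<lambda>k. walk u (2 * k))" 
    using finite_imageD[of "\<lambda>k. walk u (2 * k)" UNIV] finite_subset[OF _ fin] by auto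
  then obtain a b where ab: "a < b" "walk u (2 * a) = walk u (2 * b)"
    unfolding inj_def by (metis linorder_neqE_nat)
  have "walk u (2 * a - 2 * a) = walk u (2 * b - 2 * a)"
    by (rule walk_back[OF u _ u]) (use ab no in auto)
  thus False using no[of "2 * b - 2 * a"] ab(1) u by simp
qed

definition len :: "'v \<Rightarrow> nat" where
  "len u = (LEAST k. 0 < k \<and> walk u k \<in> X)"

definition tip :: "'v \<Rightarrow> 'v" where
  "tip u = walk u (len u)"

lemma len_pos: "u \<in> X \<Longrightarrow> 0 < len u"
  and tip_in: "u \<in> X \<Longrightarrow> tip u \<in> X"
  using LeastI_ex[OF walk_returns, of u] by (auto simp: len_def tip_def)

lemma walk_notin: "0 < j \<Longrightarrow> j < len u \<Longrightarrow> walk u j \<notin> X"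
  using not_less_Least[of j "\<lambda>k. 0 < k \<and> walk u k \<in> X"] by (auto simp: len_def)

lemma len_eqI: "0 < k \<Longrightarrow> walk u k \<in> X \<Longrightarrow> (\<And>j. 0 < j \<Longrightarrow> j < k \<Longrightarrow> walk u j \<notin> X) \<Longrightarrow> len u = k"
  unfolding len_def by (rule Least_equality) (auto simp: not_less[symmetric])

lemma walk_V: "u \<in> X \<Longrightarrow> k \<le> len u \<Longrightarrow> walk u k \<in> V"
  using walk_notin by (intro walk_in) auto

lemma walk_in_X: "u \<in> X \<Longrightarrow> k \<le> len u \<Longrightarrow> walk u k \<in> X \<Longrightarrow> k = 0 \<or> k = len u"
  using walk_notin by (metis le_neq_implies_less neq0_conv)

text \<open>The step that reaches \<open>X\<close> must be by \<open>n\<close>, since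
  \<open>m\<close> stays outside \<open>X\<close>.\<close>

lemma odd_len: assumes u: "u \<in> X" shows "odd (len u)"
proof
  assume ev: "even (len u)"
  then obtain k where k: "len u = Suc k" using len_pos[OF u] by (cases "len u") auto
  have "odd k" using ev k by simp
  hence "walk u k \<in> V - X" using walk_notin[of k u] walk_V[OF u, of k] k odd_pos[of k] by simp
  hence "walk u (len u) \<notin> X" using m_in \<open>odd k\<close> k by auto
  thus False using tip_in[OF u] by (simp add: tip_def)
qed

text \<open>As the length is odd, the last step of the walk is by \<open>n\<close>, like the first
  step from its tip; from there both alternate in the same way.\<close>

lemma walk_rev:
  assumes u: "u \<in> X" shows "k \<le> len u \<Longrightarrow> walk (tip u) k = walk u (len u - k)"
proof (induction k)
  case 0 thus ?case by (simp add: tip_def)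
next
  case (Suc k)
  define i where "i = len u - Suc k"
  have i: "len u - k = Suc i" "i < len u" using Suc.prems by (auto simp: i_def)
  have IH: "walk (tip u) k = walk u (Suc i)" using Suc i by simp
  have "odd l \<Longrightarrow> Suc k \<le> l \<Longrightarrow> even k \<longleftrightarrow> even (l - Suc k)" for l by presburger
  from this[OF odd_len[OF u] Suc.prems] have "even k \<longleftrightarrow> even i" unfolding i_def .
  moreover have "walk u i \<in> V" using walk_V[OF u] i by simp
  moreover have "walk u i \<in> V - X" if "odd i"
    using walk_V[OF u, of i] walk_notin[of i u] i that odd_pos[of i] by simp
  ultimately have "walk (tip u) (Suc k) = walk u i"
    using IH n_n[of "walk u i"] m_m[of "walk u i"] by (cases "even i") auto
  thus ?case by (simp add: i_def)
qed

lemma len_tip: assumes u: "u \<in> X" shows "len (tip u) = len u"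
proof (rule len_eqI)
  show "0 < len u" using len_pos[OF u] .
  show "walk (tip u) (len u) \<in> X" using walk_rev[OF u, of "len u"] u by simp
  fix j assume "0 < j" "j < len u"
  thus "walk (tip u) j \<notin> X" using walk_rev[OF u, of j] walk_notin[of "len u - j" u] by simp
qed

lemma tip_tip: "u \<in> X \<Longrightarrow> tip (tip u) = u"
  using walk_rev[of u "len u"] by (simp add: len_tip tip_def[of "tip u"])

text \<open>A walk returning to its start would be its own reversal. Having odd length, it has a
  middle step, whose two ends would coincide and be a fixed point of \<open>n\<close> or
  \<open>m\<close>.\<close>

lemma tip_neq: assumes u: "u \<in> X" shows "tip u \<noteq> u"
proof
  assume t: "tip u = u"
  obtain h where h: "len u = Suc (2 * h)" using odd_len[OF u] by (auto elim: oddE)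
  have eq: "walk u (Suc h) = walk u h" using walk_rev[OF u, of h] t h by simp
  have "walk u h \<in> V" using walk_V[OF u] h by simp
  moreover have "walk u h \<in> V - X" if "odd h"
    using walk_V[OF u, of h] walk_notin[of h u] h that odd_pos[of h] by simp
  ultimately show False using eq n_neq[of "walk u h"] m_neq[of "walk u h"]
    by (cases "even h") auto
qed

text \<open>Tracing back to the start of one walk puts a vertex of \<open>X\<close> at an even
  position of the other. Since lengths are odd, that position is 0.\<close>

lemma walk_meet_same_parity:
  assumes u: "u \<in> X" and v: "v \<in> X" and a: "a \<le> len u" and b: "b \<le> len v"
    and ab: "even a \<longleftrightarrow> even b" and eq: "walk u a = walk v b"
  shows "u = v \<and> a = b"
proof -
  have bk: "walk u (a - t) = walk v (b - t)" if "t \<le> a" "t \<le> b" for t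
    
    by (rule walk_back[OF u _ v _ ab eq that]) (use walk_notin a b in auto)
  have par: "even (a - b)" "even (b - a)" using ab by presburger+
  show ?thesis
  proof (cases "b \<le> a")
    case True
    hence "walk u (a - b) = v" using bk[of b] by simp
    moreover from this have "a - b = 0 \<or> a - b = len u" using walk_in_X[OF u, of "a - b"] a v by auto
    moreover have "a - b \<noteq> len u" using par odd_len[OF u] by metis
    ultimately show ?thesis using True by auto
  next
    case False
    hence "walk v (b - a) = u" using bk[of a] by simp
    moreover from this have "b - a = 0 \<or> b - a = len v" using walk_in_X[OF v, of "b - a"] b u by auto
    moreover have "b - a \<noteq> len v" using par odd_len[OF v] by metis
    ultimately show ?thesis using False by auto
  qed
qed

text \<open>For positions of opposite parity, reversing the first walk changes the parity of its
  position. Hence the walks from \<open>X\<close> are pairwise disjoint up to reversal.\<close>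

lemma walk_meet:
  assumes u: "u \<in> X" and v: "v \<in> X" and a: "a \<le> len u" and b: "b \<le> len v"
    and eq: "walk u a = walk v b"
  shows "u = v \<and> a = b \<or> tip u = v \<and> b = len u - a"
proof (cases "even a \<longleftrightarrow> even b")
  case True thus ?thesis using walk_meet_same_parity[OF u v a b _ eq] by blast
next
  case False
  have "walk (tip u) (len u - a) = walk v b" using walk_rev[OF u, of "len u - a"] a eq by simp
  moreover have "odd l \<Longrightarrow> a \<le> l \<Longrightarrow> even (l - a) \<longleftrightarrow> odd a" for l by presburger
  from this[OF odd_len[OF u] a] have "even (len u - a) \<longleftrightarrow> even b" using False by simp
  ultimately show ?thesis
    using walk_meet_same_parity[OF tip_in[OF u] v, of "len u - a" b] b len_tip[OF u] by auto
qed

lemma inj_on_walk: assumes u: "u \<in> X" shows "inj_on (walk u) {0..len u}"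
proof (rule inj_onI)
  fix a b assume "a \<in> {0..len u}" "b \<in> {0..len u}" "walk u a = walk u b"
  thus "a = b" using walk_meet[OF u u, of a b] tip_neq[OF u] by auto
qed

text \<open>From an inner vertex, \<open>m\<close> leads to the next vertex at odd positions and to
  the previous one at even positions; so deleting a whole walk together with \<open>X\<close> never
  splits a pair of \<open>m\<close>.\<close>

lemma m_walk:
  assumes u: "u \<in> X" and k: "0 < k" "k < len u"
  shows "m (walk u k) \<in> walk u ` {0..len u}"
proof (cases "odd k")
  case True
  hence "m (walk u k) = walk u (Suc k)" by simp
  thus ?thesis using k by (metis atLeastAtMost_iff imageI le0 Suc_leI)
next
  case False
  then obtain i where i: "k = Suc i" "odd i" using k by (cases k) auto
  have "walk u i \<in> V - X" using walk_V[OF u, of i] walk_notin[of i u] i k odd_pos[of i] by simp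
  hence "m (walk u k) = walk u i" using i m_m[of "walk u i"] by simp
  thus ?thesis using i(1) k by simp
qed

end

subsection \<open>Even cycles with ears\<close>

lemma mod_eq_window: "s mod L = t mod L \<Longrightarrow> s < t + L \<Longrightarrow> t < s + L \<Longrightarrow> s = t" for s t L :: nat
proof (induction s t rule: linorder_wlog)
  case (le s t)
  hence "L dvd t - s" by (metis mod_eq_dvd_iff_nat)
  thus ?case using le by (auto dest: dvd_imp_le)
qed simp

lemma mod_Suc_cancel: "Suc s mod L = Suc t mod L \<Longrightarrow> s mod L = t mod L" for s t L :: nat
proof (induction s t rule: linorder_wlog)
  case (le s t)
  hence "L dvd Suc t - Suc s" by (metis Suc_le_mono mod_eq_dvd_iff_nat)
  thus ?case using le by (metis diff_Suc_Suc mod_eq_dvd_iff_nat)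
qed simp

lemma edges_complete_graph_4:
  "edges (complete_graph 4) = {{0, 1}, {1, 2}, {2, 3}, {0, 3}, {0, 2}, {1, 3}}"
proof (rule equalityI; rule subsetI)
  fix e assume "e \<in> edges (complete_graph 4)"
  hence e: "e \<subseteq> {0..<4}" "card e = 2" by (simp_all add: complete_graph_def)
  obtain i j where ij: "e = {i, j}" "i < j"
    using e(2) unfolding card_2_iff by (metis insert_commute linorder_neqE_nat)
  hence "j < 4" using e(1) by simp
  hence "i = 0 \<and> j = 1 \<or> i = 1 \<and> j = 2 \<or> i = 2 \<and> j = 3 \<or> i = 0 \<and> j = 3 \<or> i = 0 \<and> j = 2 \<or> i = 1 \<and> j = 3"
    using ij(2) by linarith
  thus "e \<in> {{0, 1}, {1, 2}, {2, 3}, {0, 3}, {0, 2}, {1, 3}}" unfolding ij(1) by (elim disjE conjE) simp_all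
next
  fix e :: "nat set" assume "e \<in> {{0, 1}, {1, 2}, {2, 3}, {0, 3}, {0, 2}, {1, 3}}"
  thus "e \<in> edges (complete_graph 4)"
    unfolding insert_iff by (elim disjE) (simp_all add: complete_graph_def)
qed

text \<open>The vertices and edges of the cycle are indexed periodically by all natural numbers.\<close>

locale even_cycle =
  fixes G :: "('v, 'e) mgraph" and L :: nat and c :: "nat \<Rightarrow> 'v" and ce :: "nat \<Rightarrow> 'e"
  assumes G: "multigraph G" and L: "even L" "2 \<le> L"
    and c_eq: "c s = c t \<longleftrightarrow> s mod L = t mod L"
    and ce_eq: "ce s = ce t \<longleftrightarrow> s mod L = t mod L"
    and ce: "ce t \<in> edges G" "ends G (ce t) = {c t, c (Suc t)}"
begin

lemma c_inj: "c s = c t \<Longrightarrow> s < t + L \<Longrightarrow> t < s + L \<Longrightarrow> s = t"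
  and ce_inj: "ce s = ce t \<Longrightarrow> s < t + L \<Longrightarrow> t < s + L \<Longrightarrow> s = t"
  using mod_eq_window c_eq ce_eq by blast+

lemma c_in: "c t \<in> verts G"
  using G ce[of t] unfolding multigraph_def by fastforce

lemma c_window: "\<exists>t'. a \<le> t' \<and> t' < a + L \<and> c t = c t'"
proof -
  \<comment> \<open>This is \<open>t - a\<close> modulo \<open>L\<close>, written so as to avoid
    truncated subtraction.\<close>
  let ?d = "(t + (L - a mod L)) mod L"
  have "a mod L \<le> L" using L by (simp add: less_imp_le)
  have "(a + ?d) mod L = (a + (t + (L - a mod L))) mod L" by (rule mod_add_right_eq)
  also have "\<dots> = (a mod L + (t + (L - a mod L))) mod L" by (rule mod_add_left_eq[symmetric])
  also have "\<dots> = t mod L" using \<open>a mod L \<le> L\<close> by simp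
  finally have "c t = c (a + ?d)" using c_eq by simp
  moreover have "?d < L" using L by simp
  ultimately show ?thesis by (intro exI[of _ "a + ?d"]) simp
qed

text \<open>The ear has \<open>l\<close> edges, the vertices \<open>x 0, ..., x l\<close> and the
  edges \<open>y 0, ..., y (l - 1)\<close>. Excluding cycle edges matters for \<open>l = 1\<close>,
  where the ear may be a chord or an edge parallel to a cycle edge.\<close>

definition ear :: "nat \<Rightarrow> nat \<Rightarrow> nat \<Rightarrow> (nat \<Rightarrow> 'v) \<Rightarrow> (nat \<Rightarrow> 'e) \<Rightarrow> bool" where
  "ear a b l x y \<longleftrightarrow> odd l \<and> x 0 = c a \<and> x l = c b \<and> inj_on x {0..l} \<and>
     (\<forall>i. 0 < i \<and> i < l \<longrightarrow> x i \<notin> range c) \<and>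
     (\<forall>i<l. y i \<in> edges G \<and> y i \<notin> range ce \<and> ends G (y i) = {x i, x (Suc i)})"

text \<open>
  The edges in \<open>R\<close> become segments \<open>A e, \<dots>, B e\<close> of the cycle, read from \<open>a\<close> to \<open>a + L\<close>; the
  others become ears. \<open>pos v\<close> is the position of the branch vertex \<open>v\<close>.
\<close>

lemma conformal_minor_cycle_with_ears:
  fixes J :: "('a, 'b) mgraph"
  assumes J: "multigraph J" and RJ: "R \<subseteq> edges J"
    and st: "\<And>e. e \<in> edges J \<Longrightarrow> ends J e = {s e, t e}"
    and pos: "inj_on pos (verts J)" "\<And>v. v \<in> verts J \<Longrightarrow> a \<le> pos v \<and> pos v < a + L"
    and seg: "\<And>e. e \<in> R \<Longrightarrow> a \<le> A e \<and> A e < B e \<and> B e \<le> a + L \<and> odd (B e - A e)"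
    and seg_ends: "\<And>e. e \<in> R \<Longrightarrow> c (A e) = c (pos (s e)) \<and> c (B e) = c (pos (t e))"
    and seg_disj: "\<And>e e'. e \<in> R \<Longrightarrow> e' \<in> R \<Longrightarrow> e \<noteq> e' \<Longrightarrow> B e \<le> A e' \<or> B e' \<le> A e"
    and seg_pos: "\<And>e v. e \<in> R \<Longrightarrow> v \<in> verts J \<Longrightarrow> pos v \<le> A e \<or> B e \<le> pos v"
    and cover: "\<And>i. a \<le> i \<Longrightarrow> i < a + L \<Longrightarrow> \<exists>e\<in>R. A e \<le> i \<and> i < B e"
    and proper: "\<And>e. e \<in> R \<Longrightarrow> B e < A e + L"
    and ears: "\<And>e. e \<in> edges J - R \<Longrightarrow> ear (pos (s e)) (pos (t e)) (l e) (x e) (y e)"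
    and ears_disj: "\<And>e e'. e \<in> edges J - R \<Longrightarrow> e' \<in> edges J - R \<Longrightarrow> e \<noteq> e' \<Longrightarrow>
          x e ` {0..l e} \<inter> x e' ` {0..l e'} = {}"
    and rest: "matchable (delete_verts G (range c \<union> (\<Union>e\<in>edges J - R. x e ` {0..l e})))"
  shows "conformal_minor J G"
proof -
  \<comment> \<open>The number of inner vertices is one less than the length; it is even because
    segments and ears have odd length.\<close>
  define k where "k e = (if e \<in> R then B e - A e - 1 else l e - 1)" for e
  define P where "P e i = (if e \<in> R then c (A e + i) else x e i)" for e i
  define Q where "Q e i = (if e \<in> R then ce (A e + i) else y e i)" for e i
  have kR: "Suc (k e) = B e - A e" "A e + Suc (k e) = B e" if "e \<in> R" for e
    using that seg[OF that] by (auto simp: k_def)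
  have kE: "Suc (k e) = l e" if "e \<in> edges J - R" for e
    using that ears[OF that] by (auto simp: k_def ear_def odd_pos)
  have vJ: "s e \<in> verts J" "t e \<in> verts J" if "e \<in> edges J" for e
    using that J st[OF that] by (auto simp: multigraph_def)
  have E: "odd (l e)" "x e 0 = c (pos (s e))" "x e (l e) = c (pos (t e))" "inj_on (x e) {0..l e}"
      "\<And>i. 0 < i \<Longrightarrow> i < l e \<Longrightarrow> x e i \<notin> range c"
      "\<And>i. i < l e \<Longrightarrow> y e i \<in> edges G \<and> y e i \<notin> range ce \<and> ends G (y e i) = {x e i, x e (Suc i)}"
    if "e \<in> edges J - R" for e
    using ears[OF that] unfolding ear_def by blast+
  have xy_ne: "y e i \<noteq> y e' j"
    if "e \<in> edges J - R" "e' \<in> edges J - R" "e \<noteq> e'" "i < l e" "j < l e'" for e e' i j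
  proof
    assume eq: "y e i = y e' j"
    have "x e i \<in> ends G (y e i)" using E(6)[OF that(1,4)] by simp
    hence "x e i = x e' j \<or> x e i = x e' (Suc j)" using E(6)[OF that(2,5)] eq by simp
    moreover have "x e i \<in> x e ` {0..l e}" "x e' j \<in> x e' ` {0..l e'}" "x e' (Suc j) \<in> x e' ` {0..l e'}"
      using that by simp_all
    ultimately have "x e i \<in> x e ` {0..l e} \<inter> x e' ` {0..l e'}" by (elim disjE) simp_all
    thus False using ears_disj[OF that(1-3)] by simp
  qed
  show ?thesis
  proof (rule conformal_minorI[where J = J and s = s and t = t and k = k and P = P and Q = Q
        and \<phi> = "\<lambda>v. c (pos v)"])
    show "multigraph G" "multigraph J" by (rule G, rule J)
    show "ends J e = {s e, t e} \<and> even (k e)" if "e \<in> edges J" for e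
    proof (cases "e \<in> R")
      case True
      thus ?thesis using st[OF that] kR(1)[OF True] seg[OF True] by (metis even_Suc)
    next
      case False
      thus ?thesis using st[OF that] kE[of e] E(1)[of e] that by (metis DiffI even_Suc)
    qed
    show "inj_on (\<lambda>v. c (pos v)) (verts J)"
    proof (rule inj_onI)
      fix v w assume vw: "v \<in> verts J" "w \<in> verts J" "c (pos v) = c (pos w)"
      have "pos v = pos w" by (rule c_inj[OF vw(3)]) (use pos(2)[OF vw(1)] pos(2)[OF vw(2)] in linarith)+
      thus "v = w" using pos(1) vw by (simp add: inj_on_def)
    qed
    show "(\<lambda>v. c (pos v)) ` verts J \<subseteq> verts G" using c_in by auto
    show "P e 0 = c (pos (s e))" if "e \<in> edges J" for e
      using that seg_ends E(2) by (auto simp: P_def)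
    show "P e (Suc (k e)) = c (pos (t e))" if "e \<in> edges J" for e
    proof (cases "e \<in> R")
      case True
      thus ?thesis unfolding P_def using kR(2)[OF True] seg_ends[OF True] by (simp only: if_True)
    next
      case False
      thus ?thesis unfolding P_def using kE[of e] E(3)[of e] that by simp
    qed
    show "Q e i \<in> edges G \<and> ends G (Q e i) = {P e i, P e (Suc i)}" if "e \<in> edges J" "i \<le> k e" for e i
    proof (cases "e \<in> R")
      case True
      thus ?thesis using ce by (simp add: P_def Q_def)
    next
      case False
      hence "e \<in> edges J - R" using that by simp
      moreover from this have "i < l e" using kE[of e] that by simp
      ultimately show ?thesis using E(6)[of e i] False by (simp add: P_def Q_def)
    qed
    show "inj_on (P e) {0..Suc (k e)}" if "e \<in> edges J" for e
    proof (cases "e \<in> R")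
      case True
      show ?thesis
      proof (rule inj_onI)
        fix i j assume ij: "i \<in> {0..Suc (k e)}" "j \<in> {0..Suc (k e)}" "P e i = P e j"
        \<comment> \<open>By \<open>proper\<close>, a segment is shorter than the cycle, so even its
          two ends are different vertices.\<close>
        have "A e + i = A e + j"
          by (rule c_inj) (use ij True kR(2)[OF True] proper[OF True] in \<open>auto simp: P_def\<close>)
        thus "i = j" by simp
      qed
    next
      case False
      hence "P e = x e" by (auto simp: P_def)
      thus ?thesis using kE[of e] E(4)[of e] that False by simp
    qed
    show "P e i \<notin> (\<lambda>v. c (pos v)) ` verts J" if "e \<in> edges J" "0 < i" "i \<le> k e" for e i
    proof (cases "e \<in> R")
      case True
      have "A e + i \<noteq> pos v" if "v \<in> verts J" for v
        using seg_pos[OF True that] \<open>0 < i\<close> \<open>i \<le> k e\<close> kR(2)[OF True] by auto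
      moreover have "A e + i = pos v" if "v \<in> verts J" "c (A e + i) = c (pos v)" for v
        by (rule c_inj[OF that(2)])
          (use pos(2)[OF that(1)] seg[OF True] \<open>i \<le> k e\<close> kR(2)[OF True] in auto)
      ultimately show ?thesis using True by (auto simp: P_def)
    next
      case False
      thus ?thesis using E(5)[of e i] kE[of e] that by (auto simp: P_def)
    qed
    show "P e i \<noteq> P e' j"
      if e: "e \<in> edges J" "e' \<in> edges J" "e \<noteq> e'" "0 < i" "i \<le> k e" "0 < j" "j \<le> k e'" for e e' i j
    proof (cases "e \<in> R"; cases "e' \<in> R")
      assume R: "e \<in> R" "e' \<in> R"
      have "A e + i = A e' + j" if "c (A e + i) = c (A e' + j)"
        by (rule c_inj[OF that]) (use seg[OF R(1)] seg[OF R(2)] e kR(2)[OF R(1)] kR(2)[OF R(2)] in auto)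
      thus ?thesis using seg_disj[OF R e(3)] e R kR(2)[OF R(1)] kR(2)[OF R(2)] by (auto simp: P_def)
    next
      assume R: "e \<in> R" "e' \<notin> R"
      hence "x e' j \<notin> range c" using e E(5)[of e' j] kE[of e'] by simp
      thus ?thesis using R rangeI[of c "A e + i"] unfolding P_def by metis
    next
      assume R: "e \<notin> R" "e' \<in> R"
      hence "x e i \<notin> range c" using e E(5)[of e i] kE[of e] by simp
      thus ?thesis using R rangeI[of c "A e' + j"] unfolding P_def by metis
    next
      assume R: "e \<notin> R" "e' \<notin> R"
      hence "x e i \<in> x e ` {0..l e}" "x e' j \<in> x e' ` {0..l e'}" using e kE[of e] kE[of e'] by auto
      moreover have "x e ` {0..l e} \<inter> x e' ` {0..l e'} = {}" using R e by (intro ears_disj) auto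
      ultimately have "x e i \<noteq> x e' j" by (metis disjoint_iff)
      thus ?thesis using R by (simp add: P_def)
    qed
    show "Q e i \<noteq> Q e' j"
      if e: "e \<in> edges J" "e' \<in> edges J" "e \<noteq> e'" "i \<le> k e" "j \<le> k e'" for e e' i j
    proof (cases "e \<in> R"; cases "e' \<in> R")
      assume R: "e \<in> R" "e' \<in> R"
      have "A e + i = A e' + j" if "ce (A e + i) = ce (A e' + j)"
        by (rule ce_inj[OF that]) (use seg[OF R(1)] seg[OF R(2)] e kR(2)[OF R(1)] kR(2)[OF R(2)] in auto)
      thus ?thesis using seg_disj[OF R e(3)] e R kR(2)[OF R(1)] kR(2)[OF R(2)] by (auto simp: Q_def)
    next
      assume R: "e \<in> R" "e' \<notin> R"
      hence "y e' j \<notin> range ce" using e E(6)[of e' j] kE[of e'] by simp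
      thus ?thesis using R rangeI[of ce "A e + i"] unfolding Q_def by metis
    next
      assume R: "e \<notin> R" "e' \<in> R"
      hence "y e i \<notin> range ce" using e E(6)[of e i] kE[of e] by simp
      thus ?thesis using R rangeI[of ce "A e' + j"] unfolding Q_def by metis
    next
      assume R: "e \<notin> R" "e' \<notin> R"
      thus ?thesis using xy_ne[of e e' i j] e kE[of e] kE[of e'] by (simp add: Q_def)
    qed
    \<comment> \<open>\<open>?U\<close> is the vertex set of the bi-subdivision and
      \<open>?W\<close> that of the cycle with its ears. They agree because the segments cover the
      cycle and all path ends are branch vertices.\<close>
    let ?U = "(\<lambda>v. c (pos v)) ` verts J \<union> (\<Union>e\<in>edges J. P e ` {1..k e})"
    let ?W = "range c \<union> (\<Union>e\<in>edges J - R. x e ` {0..l e})"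
    have PU: "P e i \<in> ?U" if "e \<in> edges J" "0 < i" "i \<le> k e" for e i
      using that by (intro UnI2 UN_I[OF that(1)] imageI) auto
    have sU: "c (pos (s e)) \<in> ?U" "c (pos (t e)) \<in> ?U" if "e \<in> edges J" for e
      using vJ[OF that] by blast+
    have "?U \<subseteq> ?W"
    proof -
      have "P e i \<in> ?W" if "e \<in> edges J" "0 < i" "i \<le> k e" for e i
      proof (cases "e \<in> R")
        case False
        hence "e \<in> edges J - R" "i \<in> {0..l e}" using that kE[of e] by auto
        hence "x e i \<in> ?W" by (intro UnI2 UN_I[of e] imageI)
        thus ?thesis using False by (simp add: P_def)
      qed (simp add: P_def)
      hence "P e i \<in> ?W" if "e \<in> edges J" "i \<in> {1..k e}" for e i using that by simp
      hence "(\<Union>e\<in>edges J. P e ` {1..k e}) \<subseteq> ?W" by (intro UN_least image_subsetI)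
      moreover have "(\<lambda>v. c (pos v)) ` verts J \<subseteq> ?W" by (intro le_supI1 image_subsetI rangeI)
      ultimately show ?thesis by (rule Un_least[rotated])
    qed
    moreover have "range c \<subseteq> ?U"
    proof
      fix v assume "v \<in> range c"
      then obtain i where i: "a \<le> i" "i < a + L" "v = c i" using c_window[of a] by blast
      obtain e where e: "e \<in> R" "A e \<le> i" "i < B e" using cover[OF i(1,2)] by blast
      have eJ: "e \<in> edges J" using e RJ by blast
      show "v \<in> ?U"
      proof (cases "i = A e")
        case True
        thus ?thesis using sU(1)[OF eJ] seg_ends[OF e(1)] i(3) by simp
      next
        case False
        hence "P e (i - A e) \<in> ?U" using e kR(2)[OF e(1)] by (intro PU eJ) auto
        thus ?thesis using e i by (simp add: P_def)
      qed
    qed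
    moreover have xU: "x e i \<in> ?U" if "e \<in> edges J - R" "i \<le> l e" for e i
    proof -
      have eJ: "e \<in> edges J" using that by simp
      have "i = 0 \<or> i = l e \<or> 0 < i \<and> i \<le> k e" using that kE[OF that(1)] by linarith
      then consider "i = 0" | "i = l e" | "0 < i" "i \<le> k e" by blast
      thus ?thesis
      proof cases
        case 1 thus ?thesis using E(2)[OF that(1)] sU(1)[OF eJ] by simp
      next
        case 2 thus ?thesis using E(3)[OF that(1)] sU(2)[OF eJ] by simp
      next
        case 3 thus ?thesis using PU[OF eJ 3] that(1) by (simp add: P_def)
      qed
    qed
    moreover have "(\<Union>e\<in>edges J - R. x e ` {0..l e}) \<subseteq> ?U"
      by (intro UN_least image_subsetI xU) simp_all
    ultimately have "?U = ?W" by (intro equalityI Un_least[of "range c"])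
    thus "matchable (delete_verts G ?U)" using rest by simp
  qed
qed

text \<open>The vertices \<open>c a\<close> and \<open>c b\<close> cut the cycle into two paths,
  both odd since \<open>L\<close> is even; the ear is the third path between them.\<close>

lemma theta_minor:
  assumes ab: "a < b" "b < a + L" "odd (b - a)" and x: "ear a b l x y"
    and rest: "matchable (delete_verts G (range c \<union> x ` {0..l}))"
  shows "conformal_minor Theta G"
proof -
  have per: "c (a + L) = c a" using c_eq by simp
  have ev: "odd (a + L - b)" using ab L(1) by presburger
  have ED: "edges Theta - {0, 1} = {2}" by (auto simp: Theta_def)
  show ?thesis
  \<comment> \<open>Edges 0 and 1 are the segments from \<open>a\<close> to \<open>b\<close> and
    from \<open>b\<close> to \<open>a + L\<close>, edge 2 is the ear. Edge 1 is directed from vertex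
    1 to vertex 0, as its segment ends in \<open>c (a + L) = c a\<close>.\<close>
  proof (rule conformal_minor_cycle_with_ears[where R = "{0, 1}" and a = a
        and s = "\<lambda>e. if e = 1 then 1 else 0" and t = "\<lambda>e. if e = 1 then 0 else 1"
        and pos = "\<lambda>v. if v = 0 then a else b"
        and A = "\<lambda>e. if e = 0 then a else b" and B = "\<lambda>e. if e = 0 then b else a + L"
        and l = "\<lambda>_. l" and x = "\<lambda>_. x" and y = "\<lambda>_. y"], unfold ED)
    show "multigraph Theta" by (auto simp: multigraph_def Theta_def)
    show "matchable (delete_verts G (range c \<union> (\<Union>e\<in>{2}. x ` {0..l})))" using rest by simp
    show "\<exists>e\<in>{0, 1 :: nat}. (if e = 0 then a else b) \<le> i \<and> i < (if e = 0 then b else a + L)"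
      if "a \<le> i" "i < a + L" for i using that by (cases "i < b") auto
  qed (use ab ev x per in \<open>auto simp: Theta_def inj_on_def split: if_splits\<close>)
qed

text \<open>The ends of the two ears alternate around the cycle: \<open>a\<close>, \<open>p\<close>,
  \<open>b\<close>, \<open>q\<close> become the vertices 0, 1, 2, 3, the four segments form the rim,
  and the crossing ears are the edges \<open>{0, 2}\<close> and \<open>{1, 3}\<close>. The fourth
  segment is odd since the other three are and \<open>L\<close> is even.\<close>

lemma K4_minor:
  assumes pos: "a < p" "p < b" "b < q" "q < a + L" "odd (p - a)" "odd (b - p)" "odd (q - b)"
    and x: "ear a b l x y" and x': "ear p q l' x' y'"
    and disj: "x ` {0..l} \<inter> x' ` {0..l'} = {}"
    and rest: "matchable (delete_verts G (range c \<union> x ` {0..l} \<union> x' ` {0..l'}))"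
  shows "conformal_minor (complete_graph 4) G"
proof -
  let ?R = "{{0, 1}, {1, 2}, {2, 3}, {0, 3}} :: nat set set"
  \<comment> \<open>All edges run from the smaller to the larger vertex except
    \<open>{0, 3}\<close>, whose segment leads from \<open>q\<close> to
    \<open>a + L\<close>.\<close>
  let ?s = "\<lambda>e. if e = {0, 3} then 3 else Min e :: nat"
  let ?t = "\<lambda>e. if e = {0, 3} then 0 else Max e :: nat"
  let ?pos = "\<lambda>v. if v = (0 :: nat) then a else if v = 1 then p else if v = 2 then b else q"
  let ?A = "\<lambda>e :: nat set. if e = {0, 1} then a else if e = {1, 2} then p else if e = {2, 3} then b else q"
  let ?B = "\<lambda>e :: nat set. if e = {0, 1} then p else if e = {1, 2} then b else if e = {2, 3} then q else a + L"
  have per: "c (a + L) = c a" using c_eq by simp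
  have ev: "odd (a + L - q)" using pos L(1) by presburger
  have ED: "edges (complete_graph 4) - ?R = {{0, 2}, {1, 3 :: nat}}"
    by (simp add: edges_complete_graph_4 insert_Diff_if doubleton_eq_iff)
  have V: "verts (complete_graph 4) = {0, 1, 2, 3}" by (auto simp: complete_graph_def)
  have dd: "x' ` {0..l'} \<inter> x ` {0..l} = {}" using disj by blast
  show ?thesis
  proof (rule conformal_minor_cycle_with_ears[where R = ?R and a = a
        and s = ?s and t = ?t and pos = ?pos and A = ?A and B = ?B
        and l = "\<lambda>e. if e = {0, 2} then l else l'" and x = "\<lambda>e. if e = {0, 2} then x else x'"
        and y = "\<lambda>e. if e = {0, 2} then y else y'"], unfold ED)
    show "multigraph (complete_graph 4)" by (auto simp: multigraph_def complete_graph_def)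
    show "?R \<subseteq> edges (complete_graph 4)" by (simp add: edges_complete_graph_4)
    show "ends (complete_graph 4) e = {?s e, ?t e}" if "e \<in> edges (complete_graph 4)" for e
      using that unfolding edges_complete_graph_4
      by (elim insertE emptyE) (simp_all add: doubleton_eq_iff complete_graph_def insert_commute)
    show "matchable (delete_verts G (range c \<union> (\<Union>e\<in>{{0, 2}, {1, 3 :: nat}}.
        (if e = {0, 2} then x else x') ` {0..if e = {0, 2} then l else l'})))"
      using rest by (simp add: doubleton_eq_iff Un_assoc)
    show "\<exists>e\<in>?R. ?A e \<le> i \<and> i < ?B e"
      if "a \<le> i" "i < a + L" for i
      using that by (simp add: doubleton_eq_iff) linarith
    show "inj_on ?pos (verts (complete_graph 4))" using pos by (simp add: V)
    show "a \<le> ?pos v \<and> ?pos v < a + L" if "v \<in> verts (complete_graph 4)" for v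
      using pos by simp
    show "a \<le> ?A e \<and> ?A e < ?B e \<and> ?B e \<le> a + L \<and> odd (?B e - ?A e)" if "e \<in> ?R" for e
      using that pos ev by (elim insertE emptyE) (simp_all add: doubleton_eq_iff)
    show "c (?A e) = c (?pos (?s e)) \<and> c (?B e) = c (?pos (?t e))" if "e \<in> ?R" for e
      using that per by (elim insertE emptyE) (simp_all add: doubleton_eq_iff)
    show "?B e \<le> ?A e' \<or> ?B e' \<le> ?A e" if "e \<in> ?R" "e' \<in> ?R" "e \<noteq> e'" for e e'
      using that pos by (elim insertE emptyE) (simp_all add: doubleton_eq_iff)
    show "?pos v \<le> ?A e \<or> ?B e \<le> ?pos v" if "e \<in> ?R" "v \<in> verts (complete_graph 4)" for e v
      using that pos unfolding V by (elim insertE emptyE) (simp_all add: doubleton_eq_iff)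
    show "?B e < ?A e + L" if "e \<in> ?R" for e
      using that pos by (elim insertE emptyE) (simp_all add: doubleton_eq_iff)
    show "ear (?pos (?s e)) (?pos (?t e)) (if e = {0, 2} then l else l') (if e = {0, 2} then x else x')
        (if e = {0, 2} then y else y')" if "e \<in> {{0, 2}, {1, 3 :: nat}}" for e
      using that x x' by (elim insertE emptyE) (simp_all add: doubleton_eq_iff)
    show "(if e = {0, 2} then x else x') ` {0..if e = {0, 2} then l else l'} \<inter>
        (if e' = {0, 2} then x else x') ` {0..if e' = {0, 2} then l else l'} = {}"
      if "e \<in> {{0, 2}, {1, 3 :: nat}}" "e' \<in> {{0, 2}, {1, 3 :: nat}}" "e \<noteq> e'" for e e'
      using that disj dd by (elim insertE emptyE) (simp_all add: doubleton_eq_iff)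
  qed
qed

end

subsection \<open>Ears from two perfect matchings\<close>

text \<open>In one use \<open>X\<close> is the vertex set of a cycle, in the other the two ends of a
  matching edge.\<close>

locale matching_pair =
  fixes G :: "('v, 'e) mgraph" and X :: "'v set" and M N :: "'e set"
  assumes graph: "multigraph G" and X_sub: "X \<subseteq> verts G"
    and M: "perfect_matching (delete_verts G X) M" and N: "perfect_matching G N"
begin

lemma multigraph_rest: "multigraph (delete_verts G X)"
  using graph by (rule multigraph_delete_verts)

lemma verts_rest: "verts (delete_verts G X) = verts G - X"
  by (simp add: delete_verts_def)

sublocale alternating_walk "verts G" X "mate G N" "mate (delete_verts G X) M"
proof
  show "finite (verts G)" using graph by (simp add: multigraph_def)
qed (use X_sub mate_in[OF graph N] mate_neq[OF graph N] mate_mate[OF graph N]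
    mate_in[OF multigraph_rest M, unfolded verts_rest]
    mate_neq[OF multigraph_rest M, unfolded verts_rest]
    mate_mate[OF multigraph_rest M, unfolded verts_rest] in blast)+

definition walk_edge :: "'v \<Rightarrow> nat \<Rightarrow> 'e" where
  "walk_edge u k =
     (if even k then mate_edge G N (walk u k) else mate_edge (delete_verts G X) M (walk u k))"

lemma walk_edge:
  assumes u: "u \<in> X" and k: "k < len u"
  shows "walk_edge u k \<in> edges G" "ends G (walk_edge u k) = {walk u k, walk u (Suc k)}"
proof -
  have V: "walk u k \<in> verts G" using walk_V[OF u] k by simp
  have "walk_edge u k \<in> edges G \<and> ends G (walk_edge u k) = {walk u k, walk u (Suc k)}"
  proof (cases "even k")
    case True
    thus ?thesis using mate_edge_in[OF graph N V] ends_mate_edge[OF graph N V] N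
      by (auto simp: walk_edge_def perfect_matching_def)
  next
    case False
    hence VX: "walk u k \<in> verts (delete_verts G X)"
      using V walk_notin[of k u] k odd_pos[of k] by (simp add: verts_rest)
    have "mate_edge (delete_verts G X) M (walk u k) \<in> edges G"
      using mate_edge_in[OF multigraph_rest M VX] M
      by (auto simp: perfect_matching_def delete_verts_def)
    moreover have "ends (delete_verts G X) = ends G" by (simp add: delete_verts_def)
    ultimately show ?thesis
      using False ends_mate_edge[OF multigraph_rest M VX] by (simp add: walk_edge_def)
  qed
  thus "walk_edge u k \<in> edges G" "ends G (walk_edge u k) = {walk u k, walk u (Suc k)}" by auto
qed

text \<open>Each walk contains the \<open>M\<close>-partners of its inner vertices, so
  \<open>M\<close> still matches what is left. An arbitrary \<open>U\<close> allows for one ear or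
  for two.\<close>

lemma matchable_delete_walks:
  assumes U: "U \<subseteq> X"
  shows "matchable (delete_verts G (X \<union> (\<Union>u\<in>U. walk u ` {0..len u})))"
proof (rule matchable_delete_verts_mono[OF graph M])
  fix v assume v: "v \<in> verts G - X" "v \<in> X \<union> (\<Union>u\<in>U. walk u ` {0..len u})"
  then obtain u k where u: "u \<in> U" and k: "k \<le> len u" "v = walk u k" by auto
  have uX: "u \<in> X" using u U by blast
  have "k \<noteq> 0" using v(1) k(2) uX by (intro notI) simp
  moreover have "k \<noteq> len u" using v(1) k(2) tip_in[OF uX] by (auto simp: tip_def)
  ultimately have "mate (delete_verts G X) M v \<in> walk u ` {0..len u}"
    unfolding k(2) using k(1) by (intro m_walk[OF uX]) auto
  thus "mate (delete_verts G X) M v \<in> X \<union> (\<Union>u\<in>U. walk u ` {0..len u})" using u by blast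
qed simp

end

lemma perfect_matching_delete_ends:
  assumes G: "multigraph G" and M: "perfect_matching G M" and e: "e \<in> M"
  shows "perfect_matching (delete_verts G (ends G e)) (M - {e})"
proof -
  have uniq: "d = d'" if "d \<in> M" "d' \<in> M" "v \<in> ends G d" "v \<in> ends G d'" for d d' v
    using mate_edge_eq[OF G M that(1,3)] mate_edge_eq[OF G M that(2,4)] by simp
  have "\<exists>!d. d \<in> M - {e} \<and> v \<in> ends G d" if v: "v \<in> verts G - ends G e" for v
  proof -
    have "mate_edge G M v \<in> M" "v \<in> ends G (mate_edge G M v)"
      using mate_edge_in[OF G M] ends_mate_edge[OF G M] v by auto
    thus ?thesis using v uniq by (intro ex1I[of _ "mate_edge G M v"]) auto
  qed
  moreover have "M - {e} \<subseteq> edges (delete_verts G (ends G e))"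
    using M uniq e by (auto simp: delete_verts_def perfect_matching_def)
  ultimately show ?thesis by (simp add: perfect_matching_def delete_verts_def)
qed

section \<open>Theta or K4 from the ears of a conformal even cycle\<close>

context even_cycle
begin

lemma theta_or_K4:
  assumes M: "perfect_matching (delete_verts G (range c)) M" and N: "perfect_matching G N"
    and free0: "mate_edge G N (c i0) \<notin> range ce"
  shows "conformal_minor Theta G \<or> conformal_minor (complete_graph 4) G"
proof (rule disjCI)
  assume no_K4: "\<not> conformal_minor (complete_graph 4) G"
  show "conformal_minor Theta G"
  proof (rule ccontr)
    assume no_theta: "\<not> conformal_minor Theta G"
    interpret W: matching_pair G "range c" M N
      using G M N c_in by unfold_locales auto
    \<comment> \<open>At a \<open>free\<close> index the \<open>N\<close>-edge is not a cycle edge,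
      though it may be a chord. At any other index the walk has length 1 and runs along the cycle.
      \<open>P i j\<close> says that an ear leads from \<open>c i\<close> to
      \<open>c j\<close>.\<close>
    define free where "free t \<longleftrightarrow> mate_edge G N (c t) \<notin> range ce" for t
    define P where "P i j \<longleftrightarrow> free i \<and> W.tip (c i) = c j" for i j
    have ear: "ear i j (W.len (c i)) (W.walk (c i)) (W.walk_edge (c i))" if "P i j" for i j
    proof -
      have "W.walk_edge (c i) k \<notin> range ce" if k: "k < W.len (c i)" for k
      proof (cases "k = 0")
        case True
        thus ?thesis using \<open>P i j\<close> by (simp add: P_def free_def W.walk_edge_def)
      next
        case False
        hence "W.walk (c i) k \<notin> range c" using W.walk_notin k by simp
        moreover have "W.walk (c i) k \<in> ends G (W.walk_edge (c i) k)"
          using W.walk_edge(2)[OF _ k] by simp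
        ultimately show ?thesis using ce(2) by auto
      qed
      moreover have "W.walk (c i) (W.len (c i)) = c j" using \<open>P i j\<close> by (simp add: P_def W.tip_def)
      ultimately show ?thesis
        unfolding ear_def using W.odd_len W.inj_on_walk W.walk_notin W.walk_edge by auto
    qed
    \<comment> \<open>The reversed walk is an ear too: if the \<open>N\<close>-edge at
      \<open>c j\<close> were a cycle edge, it would be the whole walk from \<open>c j\<close> to
      \<open>c i\<close>, and \<open>i\<close> would not be free.\<close>
    have P_sym: "P j i" if "P i j" for i j
    proof -
      have tip: "W.tip (c i) = c j" and fi: "free i" using that by (auto simp: P_def)
      have tip': "W.tip (c j) = c i" using W.tip_tip[of "c i"] tip by simp
      have "free j"
        unfolding free_def
      proof
        assume "mate_edge G N (c j) \<in> range ce"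
        then obtain t where t: "mate_edge G N (c j) = ce t" by blast
        have "mate G N (c j) \<in> ends G (ce t)" using ends_mate_edge[OF G N c_in, of j] t by simp
        hence "W.walk (c j) 1 \<in> range c" using ce(2) by auto
        hence "W.len (c j) = 1" using W.walk_in_X[of "c j" 1] W.len_pos[of "c j"] by auto
        hence "W.tip (c j) = mate G N (c j)" by (simp add: W.tip_def)
        hence "c i \<in> ends G (mate_edge G N (c j))"
          using ends_mate_edge[OF G N c_in, of j] tip' by simp
        hence "mate_edge G N (c i) = mate_edge G N (c j)"
          by (intro mate_edge_eq[OF G N] mate_edge_in[OF G N c_in])
        thus False using fi t by (simp add: free_def)
      qed
      thus ?thesis using tip' by (simp add: P_def)
    qed
    have P_ex: "\<exists>j<L. P i j \<and> c j \<noteq> c i" if "free i" for i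
    proof -
      obtain s where "W.tip (c i) = c s" using W.tip_in[of "c i"] by blast
      moreover obtain j where "j < L" "c s = c j" using c_window[of 0 s] by auto
      ultimately show ?thesis using that W.tip_neq[of "c i"] by (intro exI[of _ j]) (auto simp: P_def)
    qed
    have rest: "matchable (delete_verts G (range c \<union> (\<Union>u\<in>U. W.walk u ` {0..W.len u})))"
      if "U \<subseteq> range c" for U
      using W.matchable_delete_walks[OF that] .
    have even_P: "even (j - i)" if "P i j" "i < j" "j < i + L" for i j
      using theta_minor[OF that(2,3) _ ear[OF that(1)]] rest[of "{c i}"] no_theta by auto
    have "\<exists>i j. P i j \<and> i < j \<and> j < L"
    proof -
      obtain i where i: "i < L" "c i0 = c i" using c_window[of 0 i0] by auto
      have "free i" using free0 i(2) by (simp add: free_def)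
      then obtain j where j: "j < L" "P i j" "c j \<noteq> c i" using P_ex by blast
      hence "j \<noteq> i" by auto
      thus ?thesis using i j P_sym by (metis linorder_neqE_nat)
    qed
    then obtain a b where "P a b \<and> a < b \<and> b < L" by blast
    \<comment> \<open>Both indices are packed into one pair \<open>z\<close> so that their distance
      can be minimized over all ears within one period.\<close>
    then obtain z where z: "P (fst z) (snd z) \<and> fst z < snd z \<and> snd z < L"
      and z_least: "\<And>z'. P (fst z') (snd z') \<and> fst z' < snd z' \<and> snd z' < L \<longrightarrow>
        snd z - fst z \<le> snd z' - fst z'"
      using ex_has_least_nat[of "\<lambda>z. P (fst z) (snd z) \<and> fst z < snd z \<and> snd z < L" "(a, b)"
          "\<lambda>z. snd z - fst z"] by auto
    define i j where "i = fst z" and "j = snd z"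
    have ij: "P i j" "i < j" "j < L" using z by (simp_all add: i_def j_def)
    have least: "j - i \<le> j' - i'" if "P i' j'" "i' < j'" "j' < L" for i' j'
      using z_least[of "(i', j')"] that by (simp add: i_def j_def)
    have ev: "even (j - i)" using even_P[OF ij(1,2)] ij(3) by simp
    have cov: "mate_edge G N v = ce t" if "v \<in> ends G (ce t)" "ce t \<in> N" for v t
      using mate_edge_eq[OF G N that(2,1)] .
    have N_in: "mate_edge G N (c t) \<in> N" for t using mate_edge_in[OF G N c_in] .
    \<comment> \<open>If \<open>N\<close> does not use the cycle edge before
      \<open>c (Suc p)\<close>, the only cycle edge it can use there is the one after.\<close>
    have step: "mate_edge G N (c (Suc p)) = ce (Suc p)"
      if p: "\<not> free (Suc p)" "mate_edge G N (c p) \<noteq> ce p" for p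
    proof -
      obtain t where t: "mate_edge G N (c (Suc p)) = ce t" using p(1) unfolding free_def by blast
      have "c (Suc p) \<in> {c t, c (Suc t)}" using ends_mate_edge[OF G N c_in, of "Suc p"] t ce(2) by auto
      moreover have "c (Suc p) \<noteq> c (Suc t)"
      proof
        assume "c (Suc p) = c (Suc t)"
        hence "Suc p mod L = Suc t mod L" using c_eq by simp
        hence "ce t = ce p" using mod_Suc_cancel ce_eq by metis
        hence "ce p \<in> N" using N_in[of "Suc p"] t by simp
        hence "mate_edge G N (c p) = ce p" by (intro cov) (simp_all add: ce)
        thus False using p(2) by simp
      qed
      ultimately show ?thesis using t c_eq ce_eq by auto
    qed
    \<comment> \<open>Otherwise \<open>N\<close> is forced along the cycle: as \<open>i\<close> is
      free, the edges \<open>ce (i + 1)\<close>, \<open>ce (i + 3)\<close>, ...,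
      \<open>ce (j - 1)\<close> all lie in \<open>N\<close>. The last index has this form because
      \<open>j - i\<close> is even, and its edge covers \<open>c j\<close> although \<open>j\<close>
      is free.\<close>
    have "\<exists>p. i < p \<and> p < j \<and> free p \<and> odd (p - i)"
    proof (rule ccontr)
      assume none: "\<not> ?thesis"
      have fwd: "mate_edge G N (c (Suc (i + 2 * r))) = ce (Suc (i + 2 * r))" if "Suc (i + 2 * r) < j" for r
        using that
      proof (induction r)
        case 0
        have "mate_edge G N (c i) \<noteq> ce i" using ij(1) by (auto simp: P_def free_def)
        moreover have "\<not> free (Suc i)" using none 0 by auto
        ultimately show ?case using step[of i] by simp
      next
        case (Suc r)
        let ?p = "i + 2 * Suc r"
        have "mate_edge G N (c (Suc (i + 2 * r))) = ce (Suc (i + 2 * r))" using Suc by simp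
        hence "mate_edge G N (c ?p) = ce (Suc (i + 2 * r))"
          using N_in[of "Suc (i + 2 * r)"] by (intro cov) (simp_all add: ce)
        moreover have "ce (Suc (i + 2 * r)) \<noteq> ce ?p"
          using ce_inj[of "Suc (i + 2 * r)" ?p] L(2) by auto
        moreover have "\<not> free (Suc ?p)" using none Suc.prems by auto
        ultimately show ?case using step[of ?p] by simp
      qed
      obtain r where r: "j = i + 2 * r + 2"
      proof -
        obtain h where "j - i = 2 * h" using ev by blast
        thus ?thesis using that[of "h - 1"] ij(2) by simp
      qed
      have "mate_edge G N (c (Suc (i + 2 * r))) = ce (Suc (i + 2 * r))" using fwd[of r] r by simp
      hence "mate_edge G N (c j) = ce (Suc (i + 2 * r))"
        using N_in[of "Suc (i + 2 * r)"] r by (intro cov) (simp_all add: ce)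
      moreover have "free j" using P_sym[OF ij(1)] by (simp add: P_def)
      ultimately show False by (simp add: free_def)
    qed
    then obtain p where p: "i < p" "p < j" "free p" "odd (p - i)" by blast
    obtain q where q: "q < L" "P p q" "c q \<noteq> c p" using P_ex[OF p(3)] by blast
    have c_neq: "c s \<noteq> c t" if "s < t" "t < L" for s t using c_inj[of s t] that by auto
    have tips: "W.tip (c i) = c j" "W.tip (c j) = c i" "W.tip (c p) = c q" "W.tip (c q) = c p"
      using ij(1) P_sym[OF ij(1)] q(2) P_sym[OF q(2)] by (simp_all add: P_def)
    have qij: "q \<noteq> i" "q \<noteq> j" using tips c_neq[of p j] c_neq[of i p] p ij by auto
    \<comment> \<open>Otherwise the ear between \<open>c p\<close> and \<open>c q\<close> would have
      its ends at a distance below the minimum \<open>j - i\<close>.\<close>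
    have "\<not> (i < q \<and> q < j)"
    proof
      assume b: "i < q \<and> q < j"
      have "q \<noteq> p" using q by auto
      thus False using least[OF q(2)] least[OF P_sym[OF q(2)]] b p ij q by linarith
    qed
    \<comment> \<open>A position before \<open>i\<close> is moved on by one period, so that
      \<open>i < p < j < q' < i + L\<close> shows the crossing.\<close>
    define q' where "q' = (if j < q then q else q + L)"
    have cq': "c q' = c q" using c_eq by (simp add: q'_def)
    have q': "j < q'" "q' < i + L"
      using \<open>\<not> (i < q \<and> q < j)\<close> qij q(1) ij unfolding q'_def by auto
    have Pq': "P p q'" using q(2) cq' by (simp add: P_def)
    have "even (q' - p)" using even_P[OF Pq'] q' p by simp
    moreover have odd_jp: "odd (j - p)" using ev p(1,2,4) by auto
    ultimately have odd_qj: "odd (q' - j)" using q'(1) p(2) by auto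
    \<comment> \<open>Walks that meet are equal or reversed, but \<open>c p\<close> is neither end
      of the first ear.\<close>
    have disj: "W.walk (c i) ` {0..W.len (c i)} \<inter> W.walk (c p) ` {0..W.len (c p)} = {}"
    proof (rule ccontr)
      assume "\<not> ?thesis"
      then obtain a b where "a \<le> W.len (c i)" "b \<le> W.len (c p)" "W.walk (c i) a = W.walk (c p) b"
        by fastforce
      hence "c i = c p \<or> W.tip (c i) = c p" using W.walk_meet[of "c i" "c p" a b] by auto
      thus False using tips c_neq[of i p] c_neq[of p j] p ij by auto
    qed
    have "conformal_minor (complete_graph 4) G"
    proof (rule K4_minor[OF p(1,2) q' p(4) odd_jp odd_qj ear[OF ij(1)] ear[OF Pq'] disj])
      show "matchable (delete_verts G (range c \<union> W.walk (c i) ` {0..W.len (c i)}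
          \<union> W.walk (c p) ` {0..W.len (c p)}))"
        using rest[of "{c i, c p}"] by (simp add: Un_assoc)
    qed
    thus False using no_K4 by simp
  qed
qed

lemma isomorphic_cycle_graph:
  assumes V: "verts G = range c" and E: "edges G = range ce"
  shows "isomorphic G (cycle_graph L)"
proof (rule isomorphic_sym)
  have rg: "bij_betw h {0..<L} (range h)"
    if h: "\<And>s t. h s = h t \<longleftrightarrow> s mod L = t mod L" for h :: "nat \<Rightarrow> 'z"
  proof (rule bij_betw_imageI)
    show "inj_on h {0..<L}" by (rule inj_onI) (simp add: h)
    have "h s \<in> h ` {0..<L}" for s
      using L h[of s "s mod L"] by (intro image_eqI[of _ _ "s mod L"]) simp_all
    thus "h ` {0..<L} = range h" by blast
  qed
  have "bij_betw c (verts (cycle_graph L)) (verts G)"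
    using rg[of c, OF c_eq] V by (simp add: cycle_graph_def)
  moreover have "bij_betw ce (edges (cycle_graph L)) (edges G)"
    using rg[of ce, OF ce_eq] E by (simp add: cycle_graph_def)
  moreover have "ends G (ce t) = c ` ends (cycle_graph L) t" for t
    using ce(2)[of t] c_eq[of "Suc t" "Suc t mod L"] by (simp add: cycle_graph_def)
  ultimately show "isomorphic (cycle_graph L) G" unfolding isomorphic_def by blast
  show "ends (cycle_graph L) t \<subseteq> verts (cycle_graph L)" if "t \<in> edges (cycle_graph L)" for t
    using that L by (auto simp: cycle_graph_def)
qed

text \<open>As \<open>G\<close> is not the cycle itself, connectedness gives an edge
  \<open>f\<close> outside the cycle with an end on it; a perfect matching through \<open>f\<close>
  makes that end the start of an ear.\<close>

lemma theta_or_K4_if_not_cycle: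
  assumes mc: "matching_covered G" and conf: "matchable (delete_verts G (range c))"
    and "\<not> isomorphic G (cycle_graph L)"
  shows "conformal_minor Theta G \<or> conformal_minor (complete_graph 4) G"
proof -
  have conn: "connected_graph G" and cov: "\<And>f. f \<in> edges G \<Longrightarrow> \<exists>N. perfect_matching G N \<and> f \<in> N"
    using mc by (auto simp: matching_covered_def)
  have "\<exists>f i. f \<in> edges G \<and> f \<notin> range ce \<and> c i \<in> ends G f"
  proof (rule ccontr)
    assume none: "\<not> ?thesis"
    have "v \<in> range c" if "(c 0, v) \<in> (adjacency G)\<^sup>*" for v
      using that
    proof (induction rule: rtrancl_induct)
      case (step u v)
      then obtain e i where e: "e \<in> edges G" "ends G e = {u, v}" "u = c i"
        unfolding adjacency_def by blast
      then obtain t where "e = ce t" using none by blast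
      hence "{u, v} = {c t, c (Suc t)}" using e(2) ce(2)[of t] by simp
      hence "v \<in> {c t, c (Suc t)}" by blast
      thus ?case by blast
    qed simp
    hence V: "verts G = range c"
      using conn c_in unfolding connected_graph_def by blast
    have "e \<in> range ce" if "e \<in> edges G" for e
    proof -
      have "card (ends G e) = 2" "ends G e \<subseteq> range c" using G that V by (auto simp: multigraph_def)
      then obtain i where "c i \<in> ends G e" by (auto simp: card_2_iff)
      thus ?thesis using none that by blast
    qed
    hence "edges G = range ce" using ce(1) by blast
    thus False using isomorphic_cycle_graph[OF V] assms(3) by simp
  qed
  then obtain f i where f: "f \<in> edges G" "f \<notin> range ce" "c i \<in> ends G f" by blast
  obtain N where N: "perfect_matching G N" "f \<in> N" using cov[OF f(1)] by blast
  obtain M where M: "perfect_matching (delete_verts G (range c)) M"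
    using conf unfolding matchable_def by blast
  have "mate_edge G N (c i) = f" using mate_edge_eq[OF G N(1,2) f(3)] .
  thus ?thesis using theta_or_K4[OF M N(1), of i] f(2) by simp
qed

end

section \<open>Existence of a conformal even cycle\<close>

lemma conformal_even_cycle_exists:
  fixes G :: "('v, 'e) mgraph"
  assumes G: "multigraph G" and M: "perfect_matching G M" and N: "perfect_matching G N"
    and e: "e \<in> M" "ends G e = {v, w}" "v \<noteq> w" and f: "f \<in> N" "v \<in> ends G f" "f \<noteq> e"
  shows "\<exists>L c ce. even_cycle G L c ce \<and> matchable (delete_verts G (range c))"
proof -
  have eG: "e \<in> edges G" "{v, w} \<subseteq> verts G"
    using e(1,2) M G unfolding perfect_matching_def multigraph_def by (blast, metis subsetD)
  interpret W: matching_pair G "{v, w}" "M - {e}" N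
    using G N eG(2) perfect_matching_delete_ends[OF G M e(1)] e(2) by unfold_locales simp_all
  define l where "l = W.len v"
  \<comment> \<open>The walk from \<open>v\<close> has \<open>l + 1\<close> vertices and ends in
    \<open>w\<close>; the edge at position \<open>l\<close> is \<open>e\<close>, which leads back to
    \<open>v\<close>. Hence the period is \<open>Suc l\<close>, even because \<open>l\<close> is
    odd.\<close>
  define c where "c t = W.walk v (t mod Suc l)" for t
  define ce where "ce t = (if t mod Suc l = l then e else W.walk_edge v (t mod Suc l))" for t
  have tip: "W.walk v l = w" using W.tip_in[of v] W.tip_neq[of v] by (auto simp: l_def W.tip_def)
  have inj: "i = j" if "W.walk v i = W.walk v j" "i \<le> l" "j \<le> l" for i j
    using inj_onD[OF W.inj_on_walk[of v] that(1)] that(2,3) by (simp add: l_def)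
  have we: "W.walk_edge v i \<in> edges G" "ends G (W.walk_edge v i) = {W.walk v i, W.walk v (Suc i)}"
    if "i < l" for i using W.walk_edge[of v i] that by (simp_all add: l_def)
  \<comment> \<open>Only the first edge has to be ruled out; it is the \<open>N\<close>-edge at
    \<open>v\<close>, which is \<open>f\<close>. If \<open>f\<close> is parallel to
    \<open>e\<close>, the cycle has length 2.\<close>
  have we_e: "W.walk_edge v i \<noteq> e" if i: "i < l" for i
  proof
    assume eq: "W.walk_edge v i = e"
    hence vw: "{W.walk v i, W.walk v (Suc i)} = {v, w}" using we(2)[OF i] e(2) by simp
    have "W.walk v i \<noteq> w" using inj[of i l] i tip by auto
    hence "W.walk v i = v" using vw by blast
    hence "i = 0" using inj[of i 0] by (simp add: i less_imp_le)
    hence "mate_edge G N v = e" using eq by (simp add: W.walk_edge_def)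
    thus False using mate_edge_eq[OF G N f(1,2)] f(3) by simp
  qed
  have we_inj: "i = j" if ij: "W.walk_edge v i = W.walk_edge v j" "i < l" "j < l" for i j
  proof -
    have "{W.walk v i, W.walk v (Suc i)} = {W.walk v j, W.walk v (Suc j)}"
      using we(2)[OF ij(2)] we(2)[OF ij(3)] ij(1) by simp
    hence "W.walk v i = W.walk v j \<or> W.walk v i = W.walk v (Suc j) \<and> W.walk v (Suc i) = W.walk v j"
      by (auto simp: doubleton_eq_iff)
    thus ?thesis using inj[of i j] inj[of i "Suc j"] inj[of "Suc i" j] ij by auto
  qed
  have lt: "t mod Suc l \<le> l" for t using mod_less_divisor[of "Suc l" t] by linarith
  have "even_cycle G (Suc l) c ce"
  proof
    show "multigraph G" by (rule G)
    show "even (Suc l)" "2 \<le> Suc l" using W.odd_len[of v] W.len_pos[of v] by (simp_all add: l_def Suc_le_eq)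
    show "c s = c t \<longleftrightarrow> s mod Suc l = t mod Suc l" for s t
      using inj[OF _ lt lt, of s t] by (auto simp: c_def)
    show "ce s = ce t \<longleftrightarrow> s mod Suc l = t mod Suc l" for s t
    proof -
      have "s mod Suc l = t mod Suc l" if eq: "ce s = ce t"
      proof (cases "s mod Suc l = l"; cases "t mod Suc l = l")
        assume "s mod Suc l \<noteq> l" "t mod Suc l \<noteq> l"
        thus ?thesis using we_inj[of "s mod Suc l" "t mod Suc l"] lt[of s] lt[of t] eq
          by (simp add: ce_def)
      next
        assume *: "s mod Suc l = l" "t mod Suc l \<noteq> l"
        hence "t mod Suc l < l" using lt[of t] by linarith
        from we_e[OF this] show ?thesis using eq * by (simp add: ce_def)
      next
        assume *: "s mod Suc l \<noteq> l" "t mod Suc l = l"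
        hence "s mod Suc l < l" using lt[of s] by linarith
        from we_e[OF this] show ?thesis using eq * by (simp add: ce_def)
      qed simp
      thus ?thesis by (auto simp: ce_def)
    qed
    show "ce t \<in> edges G" "ends G (ce t) = {c t, c (Suc t)}" for t
    proof -
      have "ce t \<in> edges G \<and> ends G (ce t) = {c t, c (Suc t)}"
      proof (cases "t mod Suc l = l")
        case True
        hence "Suc t mod Suc l = 0" by (simp add: mod_Suc)
        thus ?thesis using True e(2) eG(1) tip by (auto simp: c_def ce_def)
      next
        case False
        hence "t mod Suc l < l" using lt[of t] by linarith
        moreover have "Suc t mod Suc l = Suc (t mod Suc l)" using False by (simp add: mod_Suc)
        ultimately show ?thesis using we[of "t mod Suc l"] False by (simp add: c_def ce_def)
      qed
      thus "ce t \<in> edges G" "ends G (ce t) = {c t, c (Suc t)}" by auto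
    qed
  qed
  moreover have "range c = {v, w} \<union> (\<Union>u\<in>{v}. W.walk u ` {0..W.len u})"
  proof -
    have "range c \<subseteq> W.walk v ` {0..l}" using lt by (auto simp: c_def)
    moreover have "W.walk v i \<in> range c" if "i \<le> l" for i
      using that by (intro range_eqI[of _ _ i]) (simp add: c_def)
    hence "W.walk v ` {0..l} \<subseteq> range c" by auto
    ultimately have "range c = W.walk v ` {0..l}" by (rule equalityI)
    moreover have "v \<in> W.walk v ` {0..l}" by (rule image_eqI[of _ _ 0]) simp_all
    moreover have "w \<in> W.walk v ` {0..l}" using tip by (intro image_eqI[of _ _ l]) simp_all
    ultimately show ?thesis by (simp add: l_def[symmetric] insert_absorb)
  qed
  hence "matchable (delete_verts G (range c))" using W.matchable_delete_walks[of "{v}"] by simp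
  ultimately show ?thesis by blast
qed

section \<open>Matching covered graphs other than K2 and the even cycles\<close>

theorem theorem1p5:
  fixes G :: "('v, 'e) mgraph"
  assumes "matching_covered G"
    and "\<not> K2_or_even_cycle G"
  shows "conformal_minor Theta G \<or> conformal_minor (complete_graph 4) G"
proof -
  have G: "multigraph G" and conn: "connected_graph G" and card: "2 \<le> card (verts G)"
    and cov: "\<And>f. f \<in> edges G \<Longrightarrow> \<exists>N. perfect_matching G N \<and> f \<in> N"
    using assms(1) by (auto simp: matching_covered_def)
  \<comment> \<open>Two distinct edges sharing the vertex \<open>v\<close> suffice: perfect
    matchings through each of them produce a conformal even cycle.\<close>
  have step: ?thesis
    if e: "e \<in> edges G" "ends G e = {v, w}" "v \<noteq> w" and f: "f \<in> edges G" "v \<in> ends G f" "f \<noteq> e"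
    for e f v w
  proof -
    obtain M N where M: "perfect_matching G M" "e \<in> M" and N: "perfect_matching G N" "f \<in> N"
      using cov e(1) f(1) by blast
    obtain L c ce where "even_cycle G L c ce" and conf: "matchable (delete_verts G (range c))"
      using conformal_even_cycle_exists[OF G M(1) N(1) M(2) e(2,3) N(2) f(2,3)] by blast
    then interpret even_cycle G L c ce by blast
    have "\<not> isomorphic G (cycle_graph L)" using assms(2) L by (auto simp: K2_or_even_cycle_def)
    thus ?thesis using theta_or_K4_if_not_cycle[OF assms(1) conf] by blast
  qed
  obtain x y where xy: "x \<in> verts G" "y \<in> verts G" "x \<noteq> y"
    using card by (metis card_le_Suc0_iff_eq G multigraph_def not_less_eq_eq numeral_2_eq_2)
  hence "(x, y) \<in> (adjacency G)\<^sup>*" using conn by (simp add: connected_graph_def)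
  then obtain z where "(x, z) \<in> adjacency G" using xy(3) by (metis converse_rtranclE)
  then obtain e where e: "e \<in> edges G" "ends G e = {x, z}" by (auto simp: adjacency_def)
  have "card {x, z} = 2" using G e by (auto simp: multigraph_def)
  hence xz: "x \<noteq> z" by auto
  \<comment> \<open>If no other edge meets \<open>e\<close>, connectedness reduces \<open>G\<close>
    to \<open>e\<close> and its ends, the excluded \<open>complete_graph 2\<close>.\<close>
  have "\<exists>f\<in>edges G. f \<noteq> e \<and> (x \<in> ends G f \<or> z \<in> ends G f)"
  proof (rule ccontr)
    assume none: "\<not> ?thesis"
    have reach: "v \<in> {x, z}" if "(x, v) \<in> (adjacency G)\<^sup>*" for v
      using that
    proof (induction rule: rtrancl_induct)
      case (step u v)
      then obtain d where d: "d \<in> edges G" "ends G d = {u, v}" unfolding adjacency_def by blast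
      hence "d = e" using none step.IH by auto
      thus ?case using d(2) e(2) by auto
    qed simp
    have V: "verts G = {x, z}"
    proof
      show "verts G \<subseteq> {x, z}" using reach conn xy(1) unfolding connected_graph_def by blast
      show "{x, z} \<subseteq> verts G" using e G by (auto simp: multigraph_def)
    qed
    have E: "edges G = {e}"
    proof -
      have "d = e" if d: "d \<in> edges G" for d
      proof -
        have "card (ends G d) = 2" "ends G d \<subseteq> {x, z}" using G d V by (auto simp: multigraph_def)
        hence "x \<in> ends G d \<or> z \<in> ends G d" by (auto simp: card_2_iff)
        thus ?thesis using none d by blast
      qed
      thus ?thesis using e(1) by blast
    qed
    have K: "verts (complete_graph 2) = {0, 1}" "edges (complete_graph 2) = {{0, 1}}"
    proof -
      have two: "{0..<2} = {0, 1 :: nat}" by auto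
      thus "verts (complete_graph 2) = {0, 1}" by (simp add: complete_graph_def)
      have "d \<subseteq> {0, 1} \<and> card d = 2 \<longleftrightarrow> d = {0, 1}" for d :: "nat set"
        using card_subset_eq[of "{0, 1}" d] by auto
      thus "edges (complete_graph 2) = {{0, 1}}" by (simp add: complete_graph_def two)
    qed
    have "isomorphic (complete_graph 2) G"
      unfolding isomorphic_def
    proof (intro exI conjI ballI)
      let ?f = "\<lambda>i. if i = (0 :: nat) then x else z"
      show "bij_betw ?f (verts (complete_graph 2)) (verts G)"
        unfolding K V using xz by (auto simp: bij_betw_def inj_on_def)
      show "bij_betw (\<lambda>_. e) (edges (complete_graph 2)) (edges G)"
        unfolding K E by (simp add: bij_betw_def)
      show "ends G e = ?f ` ends (complete_graph 2) d" if "d \<in> edges (complete_graph 2)" for d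
        using that e(2) unfolding K by (simp add: complete_graph_def insert_commute)
    qed
    hence "isomorphic G (complete_graph 2)"
      by (rule isomorphic_sym) (simp add: complete_graph_def)
    thus False using assms(2) by (simp add: K2_or_even_cycle_def)
  qed
  then obtain f where f: "f \<in> edges G" "f \<noteq> e" "x \<in> ends G f \<or> z \<in> ends G f" by blast
  \<comment> \<open>The ends of \<open>e\<close> swap roles when the common vertex is
    \<open>z\<close>.\<close>
  have "ends G e = {z, x}" using e(2) by (simp add: insert_commute)
  thus ?thesis using f(3) step[OF e xz f(1) _ f(2)] step[OF e(1) _ xz[symmetric] f(1) _ f(2)] by blast
qed

end
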